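(* For each $\nu\in\mathbb{Z}_{\geq 0}$ there are only a finite number of possibilities for the dual area (the area of $P^*$) and for the number of vertices of a Fano polygon $P$ with $\nu$ residual lattice points.
   Context: Let $N\cong\mathbb{Z}^2$, $N_{\mathbb{Q}}=N\otimes_{\mathbb{Z}}\mathbb{Q}$, $M=\operatorname{Hom}(N,\mathbb{Z})$, $M_{\mathbb{Q}}=M\otimes_{\mathbb{Z}}\mathbb{Q}$. A Fano polygon is a convex polygon $P\subset N_{\mathbb{Q}}$ whose vertices are primitive lattice points of $N$ and which contains the origin in its strict interior. The dual polygon is $P^*=\{u\in M_{\mathbb{Q}}: u(v)\geq -1\text{ for all }v\in P\}$; area is normalised with respect to the lattice $M$. Residual lattice points. For an edge $E$ of $P$ with primitive inner normal $w_E\in M$, the height is $r_E=-w_E(E)>0$ and the width is $k_E=|E\cap N|-1$. Write $k_E=n_Er_E+k_0$ with $0\leq k_0<r_E$. The edge can be decomposed into $n_E$ lattice segments of width $r_E$ with primitive endpoints and, if $k_0\neq 0$, one additional lattice segment of width $k_0$ with primitive endpoints; the cone over this additional segment is called a residual cone. Fix such a decomposition for every edge. A lattice point of $P$ is residual if it lies in the strict interior of a residual cone. The number of residual lattice points does not depend on the chosen decomposition. *)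

theory Defs
  imports "HOL-Analysis.Analysis"
begin

text \<open>
  We take N to be the integer lattice in the plane and extend scalars to the reals, so that
  convex hulls and areas are those of the library; a polygon with lattice vertices is determined
  by its vertices, and so is its rational dual, so nothing changes with respect to working
  over the rationals.  The dual lattice M is identified with the integer
  lattice as well, \<open>u\<close> acting on \<open>v\<close> by the inner product \<open>u \<bullet> v\<close>.
\<close>

definition lattice :: "(real^2) set" where
  "lattice = {v. \<forall>i. v $ i \<in> \<int>}"

definition primitive :: "real^2 \<Rightarrow> bool" where
  "primitive v \<longleftrightarrow> (\<exists>a b :: int. coprime a b \<and> v = vector [of_int a, of_int b])"

definition polygon_vertices :: "(real^2) set \<Rightarrow> (real^2) set" where
  "polygon_vertices P = {v. v extreme_point_of P}"

definition fano_polygon :: "(real^2) set \<Rightarrow> bool" where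
  "fano_polygon P \<longleftrightarrow>
     polytope P \<and> (\<forall>v \<in> polygon_vertices P. primitive v) \<and> 0 \<in> interior P"

definition dual_polygon :: "(real^2) set \<Rightarrow> (real^2) set" where
  "dual_polygon P = {u. \<forall>v\<in>P. u \<bullet> v \<ge> -1}"

text \<open>Lattice-normalised area: a triangle spanned by a lattice basis has area 1.\<close>

definition dual_area :: "(real^2) set \<Rightarrow> real" where
  "dual_area P = 2 * measure lebesgue (dual_polygon P)"

text \<open>For an edge of a Fano polygon the objects described by \<open>THE\<close> below exist uniquely.\<close>

definition inner_normal :: "(real^2) set \<Rightarrow> (real^2) set \<Rightarrow> real^2" where
  "inner_normal P E =
     (THE w. primitive w \<and> (\<exists>c. (\<forall>x\<in>E. w \<bullet> x = c) \<and> (\<forall>x\<in>P. w \<bullet> x \<ge> c)))"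

definition edge_height :: "(real^2) set \<Rightarrow> (real^2) set \<Rightarrow> nat" where
  "edge_height P E = (THE r. \<forall>x\<in>E. inner_normal P E \<bullet> x = - real r)"

definition lattice_width :: "(real^2) set \<Rightarrow> nat" where
  "lattice_width s = card (s \<inter> lattice) - 1"

text \<open>
  \<open>T\<close> is the set of segments of width equal to the height of the edge \<open>E\<close>, and \<open>R\<close> is empty or
  consists of the one additional segment, over which the residual cone is taken.
\<close>

definition edge_decomposition ::
  "(real^2) set \<Rightarrow> (real^2) set \<Rightarrow> (real^2) set set \<Rightarrow> (real^2) set set \<Rightarrow> bool" where
  "edge_decomposition P E T R \<longleftrightarrow>
     (let r = edge_height P E; n = lattice_width E div r; k\<^sub>0 = lattice_width E mod r in
       finite T \<and> card T = n \<and> (\<forall>s\<in>T. lattice_width s = r) \<and>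
       (if k\<^sub>0 = 0 then R = {} else \<exists>s. R = {s} \<and> lattice_width s = k\<^sub>0) \<and>
       (\<forall>s \<in> T \<union> R. \<exists>a b. primitive a \<and> primitive b \<and> s = closed_segment a b) \<and>
       \<Union>(T \<union> R) = E \<and>
       pairwise (\<lambda>s t. disjnt (rel_interior s) (rel_interior t)) (T \<union> R))"

definition polygon_decomposition ::
  "(real^2) set \<Rightarrow> ((real^2) set \<Rightarrow> (real^2) set set) \<Rightarrow> ((real^2) set \<Rightarrow> (real^2) set set) \<Rightarrow> bool"
  where
  "polygon_decomposition P T R \<longleftrightarrow>
     (\<forall>E. E edge_of P \<longrightarrow> edge_decomposition P E (T E) (R E))"

definition residual_points ::
  "(real^2) set \<Rightarrow> ((real^2) set \<Rightarrow> (real^2) set set) \<Rightarrow> (real^2) set" where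
  "residual_points P R =
     {v \<in> P \<inter> lattice. \<exists>E. E edge_of P \<and> (\<exists>s \<in> R E. v \<in> interior (conic hull s))}"

text \<open>
  The number of residual points does not depend on the decomposition, so the existential
  quantifier could equally well be universal.
\<close>

definition has_residual_points :: "(real^2) set \<Rightarrow> nat \<Rightarrow> bool" where
  "has_residual_points P \<nu> \<longleftrightarrow>
     (\<exists>T R. polygon_decomposition P T R \<and> card (residual_points P R) = \<nu>)"

end

theory Submission
  imports Defs
begin

text \<open>
  The theorem follows from a formula for the dual area. For a lattice cone spanned by primitive
  vectors \<open>u\<close>, \<open>w\<close> in counterclockwise order, with \<open>d = det (u, w)\<close>, and a primitive integral
  linear form \<open>X\<close>, consider
    \<open>G (u, w) = (2 - X u / X w - X w / X u) / d\<close>.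
  Cutting the dual polygon into triangles with apex at the origin, one for each vertex of \<open>P\<close>,
  shows that the dual area is the sum of \<open>G\<close> over the edges of \<open>P\<close>; moreover \<open>G\<close> is additive when
  an edge is cut into segments.

  For a unimodular cone, \<open>G (u, w) + 1 = 3 - X u / X w - X w / X u\<close>, and this is additive under
  insertion of the ray \<open>u + w\<close>. It is therefore a difference \<open>f u - f w\<close> of values
  of one function \<open>f\<close> on primitive vectors, as long as the cone does not meet the line \<open>X = 0\<close>; a
  cone that meets this line requires the correction 6. The function \<open>f\<close> is a Dedekind sum in
  disguise, and is defined here by recursion along the Farey tree. The number
    \<open>A (u, w) = G (u, w) + f w - f u - (6 if the cone meets X = 0)\<close>
  thus equals -1 on unimodular cones. Cutting an arbitrary cone
  into unimodular ones shows that \<open>A\<close> does not depend on \<open>X\<close> and that it takes finitely many values on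
  the cones with \<open>d \<le> D\<close>. For a cone over a segment of width equal to its height one can take \<open>X\<close> to
  be constant on the segment; then \<open>G\<close> vanishes, the endpoints differ by a shear, and \<open>A = -1\<close>.

  Now sum \<open>A\<close> over all segments of the decomposition of \<open>P\<close>. The values of \<open>f\<close> telescope around
  the polygon, so that
    \<open>dual area = 6 c - n + (sum of A over the residual cones)\<close>,
  where \<open>c \<le> 2\<close> is the number of edges that meet the line \<open>X = 0\<close> and \<open>n\<close> is the number of segments
  of full width (in fact \<open>c = 2\<close>, which gives the constant 12 of Noether's formula, but the bound is
  all that finiteness asks for).

  Finally, a residual cone of determinant \<open>d \<ge> 2\<close> contains at least \<open>(d - 1) / 2\<close> residual lattice
  points: a nonzero class of the lattice modulo \<open>u\<close> and \<open>w\<close> has a representative in the interior of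
  the parallelogram, and either it or its reflection lies in the triangle. Points of different
  residual cones are different, so \<open>\<nu>\<close> bounds both the number of residual cones and their
  determinants, and the last sum takes finitely many values. As the dual area is not negative, \<open>n\<close> is
  bounded, and with it the number of edges.
\<close>

section \<open>A function on the Farey tree\<close>

text \<open>
  The value at the primitive vector \<open>(p, q)\<close> with \<open>p > 0\<close>; up to the summand \<open>- q / p\<close> and sign
  it is twelve times a Dedekind sum. The vector \<open>(p, q)\<close> with \<open>p > 1\<close> is the sum of two
  vectors with smaller positive first entries that form a lattice basis (its Farey parents), and
  the recursion goes to the parent \<open>(s, t)\<close> on its clockwise side. The test on \<open>s\<close> makes the
  recursion terminate on pairs that are not coprime.
\<close>

function rademacher :: "int \<Rightarrow> int \<Rightarrow> real" where
  "rademacher p q =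
     (let s = (SOME s. 0 < s \<and> s < p \<and> p dvd s * q - 1)
      in if 0 < s \<and> s < p
         then rademacher s ((s * q - 1) div p) + s / p + p / s - 3
         else - of_int q)"
  by pat_completeness auto
termination by (relation "Wellfounded.measure (\<lambda>(p, q). nat p)") auto

declare rademacher.simps [simp del]

lemma rademacher_1: "rademacher 1 q = - of_int q"
  by (subst rademacher.simps) (simp add: Let_def)

lemma rademacher_parent:
  assumes "s * q - t * p = 1" "0 < s" "s < p"
  shows "rademacher p q = rademacher s t + s / p + p / s - 3"
proof -
  let ?P = "\<lambda>s. 0 < s \<and> s < p \<and> p dvd s * q - 1"
  have P: "?P s"
    using assms by (auto simp: algebra_simps dvd_def)
  have "s' = s" if "?P s'" for s'
  proof -
    have "p dvd (s * q - 1) * s' - (s' * q - 1) * s"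
      using P that by (simp add: dvd_diff)
    moreover have "(s * q - 1) * s' - (s' * q - 1) * s = s - s'"
      by (simp add: algebra_simps)
    ultimately have "p dvd s - s'" by simp
    then have "p dvd \<bar>s - s'\<bar>" by simp
    moreover have "\<bar>s - s'\<bar> < p" using P that by auto
    ultimately show ?thesis using zdvd_not_zless[of "\<bar>s - s'\<bar>" p] by fastforce
  qed
  with P have "(SOME s. ?P s) = s" by (metis (mono_tags, lifting) some_equality)
  moreover have "(s * q - 1) div p = t"
  proof -
    have "s * q - 1 = t * p" using assms by linarith
    then show ?thesis using assms(2,3) by (metis less_trans nonzero_mult_div_cancel_right order_less_irrefl)
  qed
  ultimately show ?thesis
    using assms by (subst rademacher.simps) (simp add: Let_def)
qed

text \<open>
  The recursion prescribes this difference only for a vector and its clockwise parent. It holds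
  for every lattice basis in the half plane because \<open>x / y + y / x - 3\<close> is additive when a
  basis \<open>(u - v, v)\<close> is subdivided by its sum \<open>u\<close>.
\<close>

lemma rademacher_adjacent:
  assumes "p * q' - q * p' = 1" "0 < p" "0 < p'"
  shows "rademacher p' q' - rademacher p q = p / p' + p' / p - 3"
  using assms
proof (induction "nat (p + p')" arbitrary: p q p' q' rule: less_induct)
  case less
  consider "p < p'" | "p = p'" | "p' < p" by linarith
  then show ?case
  proof cases
    case 1
    then show ?thesis
      using rademacher_parent[of p q' q p'] less.prems by simp
  next
    case 2
    then have "p * (q' - q) = 1" using less.prems by (simp add: algebra_simps)
    then have "p = 1" using less.prems by (smt (verit) zmult_eq_1_iff)
    then show ?thesis using 2 less.prems by (simp add: rademacher_1)
  next
    case 3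
    have "rademacher p' q' - rademacher (p - p') (q - q') = (p - p') / p' + p' / (p - p') - 3"
      using less.hyps[of "p - p'" p' q' "q - q'"] less.prems 3 by (simp add: algebra_simps)
    moreover have "rademacher p q = rademacher (p - p') (q - q') + (p - p') / p + p / (p - p') - 3"
      using rademacher_parent[of "p - p'" q "q - q'" p] less.prems 3 by (simp add: algebra_simps)
    moreover have "(p - p') / p' = p / p' - 1" "(p - p') / p = 1 - p' / p"
        "p' / (p - p') = p / (p - p') - 1"
      using less.prems 3 by (simp_all add: diff_divide_distrib[symmetric] divide_simps)
    ultimately show ?thesis
      using less.prems 3 by simp
  qed
qed

lemma parent_exists:
  fixes p q :: int
  assumes "coprime p q" "1 < p"
  obtains s t where "s * q - t * p = 1" "0 < s" "s < p"
proof -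
  obtain a b where ab: "a * p + b * q = 1"
    using assms(1) by (metis bezout_int coprime_iff_gcd_eq_1)
  define s where "s = b mod p"
  define t where "t = - a - (b div p) * q"
  have b: "b = p * (b div p) + s" by (simp add: s_def)
  have "s * q - t * p = (p * (b div p) + s) * q + a * p"
    by (simp add: t_def algebra_simps)
  then have 1: "s * q - t * p = 1" using ab b by simp
  have "s \<noteq> 0"
  proof
    assume "s = 0"
    then have "p * - t = 1" using 1 by (simp add: algebra_simps)
    then show False using assms by (metis pos_zmult_eq_1_iff less_trans zero_less_one order_less_irrefl)
  qed
  then have "0 < s" "s < p" using assms pos_mod_sign[of p b] pos_mod_bound[of p b] unfolding s_def by linarith+
  with 1 that show ?thesis by blast
qed

text \<open>
  A shear along the vertical axis maps the Farey parents of a vector to those of its image, and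
  thus preserves all terms of the recursion; only the initial value changes.
\<close>

lemma rademacher_shift:
  assumes "coprime p q" "0 < p"
  shows "rademacher p (q + p) = rademacher p q - 1"
  using assms
proof (induction "nat p" arbitrary: p q rule: less_induct)
  case less
  show ?case
  proof (cases "p = 1")
    case True
    then show ?thesis by (simp add: rademacher_1)
  next
    case False
    then have "1 < p" using less.prems by simp
    then obtain s t where st: "s * q - t * p = 1" "0 < s" "s < p"
      using parent_exists[OF less.prems(1)] by blast
    have "coprime s t"
    proof (rule coprimeI)
      fix c assume "c dvd s" "c dvd t"
      then have "c dvd s * q - t * p" by (meson dvd_diff dvd_mult2)
      then show "is_unit c" using st by simp
    qed
    then have "rademacher s (t + s) = rademacher s t - 1" using less.hyps[of s t] st by simp
    moreover have "rademacher p (q + p) = rademacher s (t + s) + s / p + p / s - 3"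
      using st by (intro rademacher_parent) (simp_all add: algebra_simps)
    moreover have "rademacher p q = rademacher s t + s / p + p / s - 3"
      using st by (intro rademacher_parent)
    ultimately show ?thesis by simp
  qed
qed

section \<open>The defect of a lattice cone\<close>

text \<open>
  Opposite vectors get the same value, so that the left half plane is covered as well. Two
  adjacent vectors on different sides of the vertical axis then violate the difference formula
  by exactly 6: replacing one of them by its opposite changes the sign of both quotients, but also
  exchanges the order of the two vectors, so that the sum of the quotients is right and the
  constant 3 gets the wrong sign.
\<close>

definition even_rademacher :: "int \<Rightarrow> int \<Rightarrow> real" where
  "even_rademacher p q = (if 0 < p then rademacher p q else rademacher (- p) (- q))"

text \<open>
  The cone is spanned by \<open>(p, q)\<close> and \<open>(p', q')\<close>, and the linear form is the first coordinate.
  The first summand is the contribution of the cone to the dual area.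
\<close>

definition cone_defect :: "int \<Rightarrow> int \<Rightarrow> int \<Rightarrow> int \<Rightarrow> real" where
  "cone_defect p q p' q' =
     (2 - p / p' - p' / p) / (p * q' - q * p') + even_rademacher p' q' - even_rademacher p q
     - (if p * p' < 0 then 6 else 0)"

lemma cone_defect_adjacent:
  assumes "p * q' - q * p' = 1" "p \<noteq> 0" "p' \<noteq> 0"
  shows "cone_defect p q p' q' = - 1"
proof -
  have d: "real_of_int p * q' - real_of_int q * p' = 1"
    using assms(1) by (metis of_int_1 of_int_diff of_int_mult)
  \<comment> \<open>If the signs differ, one vector is replaced by its opposite and the order of the two is exchanged.\<close>
  consider "0 < p" "0 < p'" | "p < 0" "p' < 0" | "0 < p" "p' < 0" | "p < 0" "0 < p'"
    using assms by linarith
  then show ?thesis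
  proof cases
    case 1
    have np: "\<not> p * p' < 0"
      using 1 by (simp add: not_less)
    show ?thesis using rademacher_adjacent[of p q' q p'] assms 1 d np
      by (simp add: cone_defect_def even_rademacher_def)
  next
    case 2
    have np: "\<not> p * p' < 0"
      using 2 by (simp add: not_less mult_nonpos_nonpos)
    show ?thesis using rademacher_adjacent[of "- p" "- q'" "- q" "- p'"] assms 2 d np
      by (simp add: cone_defect_def even_rademacher_def)
  next
    case 3
    have np: "p * p' < 0" using 3 by (simp add: mult_pos_neg)
    show ?thesis using rademacher_adjacent[of "- p'" "q" "- q'" "p"] assms 3 d np
      by (simp add: cone_defect_def even_rademacher_def algebra_simps)
  next
    case 4
    have np: "p * p' < 0" using 4 by (simp add: mult_neg_pos)
    show ?thesis using rademacher_adjacent[of "p'" "- q" "q'" "- p"] assms 4 d np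
      by (simp add: cone_defect_def even_rademacher_def algebra_simps)
  qed
qed

text \<open>
  The contributions to the dual area of a cone and of its two parts differ by a number that is
  independent of the linear form. Here \<open>p\<close>, \<open>m\<close>, \<open>p'\<close> are the values of the form on the three
  rays, where the cone on \<open>p\<close> and \<open>m\<close> is unimodular.
\<close>

lemma split_identity:
  fixes p m p' d e :: real
  assumes "d * m = p' + e * p" "p \<noteq> 0" "p' \<noteq> 0" "m \<noteq> 0" "d \<noteq> 0" "e \<noteq> 0"
  shows "(2 - p / p' - p' / p) / d =
    (2 - p / m - m / p) + (2 - m / p' - p' / m) / e + (d - e - 1)\<^sup>2 / (d * e)"
proof -
  have "m = (p' + e * p) / d" using assms by (simp add: field_simps)
  have 1: "m / p = (p' / p + e) / d" "m / p' = (1 + e * (p / p')) / d"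
    using assms by (simp_all add: field_simps)
  have 2: "p / m + p' / m / e = d / e"
    using assms by (simp add: divide_simps)
  have "(2 - p / m - m / p) + (2 - m / p' - p' / m) / e
      = 2 + 2 / e - m / p - m / p' / e - (p / m + p' / m / e)"
    by (simp add: diff_divide_distrib)
  also have "\<dots> = 2 + 2 / e - (p' / p + e) / d - (1 + e * (p / p')) / d / e - d / e"
    by (simp only: 1 2)
  also have "\<dots> = (2 - p / p' - p' / p) / d - (d - e - 1)\<^sup>2 / (d * e)"
    using assms(5,6) by (simp add: field_simps power2_eq_square)
  finally show ?thesis by simp
qed

lemma cone_defect_split:
  fixes d e :: int
  assumes "p * n - q * m = 1" "m * q' - n * p' = e" "p * q' - q * p' = d" "0 < d" "0 < e"
    and "p \<noteq> 0" "p' \<noteq> 0" "m \<noteq> 0"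
  shows "cone_defect p q p' q' = cone_defect m n p' q' - 1 + (d - e - 1)\<^sup>2 / (d * e)"
proof -
  have m: "d * m = p' + e * p"
    using assms(1,2,3) by algebra
  have "real_of_int (d * m) = real_of_int (p' + e * p)" using m by (rule arg_cong)
  then have split: "(2 - p / p' - p' / p) / d =
    (2 - p / m - m / p) + (2 - m / p' - p' / m) / e + (real_of_int d - e - 1)\<^sup>2 / (d * e)"
    using split_identity[of d m p' e p] assms(4-8) by simp
  have cross: "(if p * p' < 0 then 6 else 0) =
      (if p * m < 0 then 6 else 0) + (if m * p' < 0 then 6 else (0::real))"
  proof -
    have "0 < p \<Longrightarrow> 0 < p' \<Longrightarrow> 0 < d * m" "p < 0 \<Longrightarrow> p' < 0 \<Longrightarrow> d * m < 0"
      using m assms(5) by (auto simp: add_pos_pos mult_pos_neg add_neg_neg)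
    then have "0 < p \<Longrightarrow> 0 < p' \<Longrightarrow> 0 < m" "p < 0 \<Longrightarrow> p' < 0 \<Longrightarrow> m < 0"
      using assms(4) by (auto simp: zero_less_mult_iff mult_less_0_iff)
    then show ?thesis using assms(6-8)
      by (auto simp: mult_less_0_iff neq_iff)
  qed
  have d: "real_of_int p * q' - real_of_int q * p' = d" "real_of_int m * q' - real_of_int n * p' = e"
      "real_of_int p * n - real_of_int q * m = 1"
    using assms(1,2,3) by (metis of_int_1 of_int_diff of_int_mult)+
  have "cone_defect p q p' q' = cone_defect p q m n + cone_defect m n p' q' + (d - e - 1)\<^sup>2 / (d * e)"
    unfolding cone_defect_def using split cross d by simp
  then show ?thesis
    using cone_defect_adjacent[of p n q m] assms by simp
qed

text \<open>
  \<open>K\<close> is the defect of the cone in every unimodular coordinate system in which the calculation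
  meets no vertical vector. The finite set \<open>W\<close> collects the rays that occur in a subdivision of the
  cone into unimodular cones; as they lie in the cone, none of them is vertical if both spanning
  vectors have positive first coordinate.
\<close>

definition cone_value :: "int \<Rightarrow> int \<Rightarrow> int \<Rightarrow> int \<Rightarrow> real \<Rightarrow> bool" where
  "cone_value p q p' q' K \<longleftrightarrow>
     (\<exists>W :: (int \<times> int) set. finite W \<and> (0, 0) \<notin> W \<and>
       (\<forall>a b c d. a * d - b * c = 1 \<longrightarrow>
          0 < a * p + b * q \<and> 0 < a * p' + b * q' \<or> (\<forall>(m, n) \<in> W. a * m + b * n \<noteq> 0) \<longrightarrow>
          cone_defect (a * p + b * q) (c * p + d * q) (a * p' + b * q') (c * p' + d * q') = K))"

lemma transformed_det:
  fixes a b c d :: int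
  assumes "a * d - b * c = 1"
  shows "(a * p + b * q) * (c * p' + d * q') - (c * p + d * q) * (a * p' + b * q') = p * q' - q * p'"
proof -
  have "(a * p + b * q) * (c * p' + d * q') - (c * p + d * q) * (a * p' + b * q')
      = (a * d - b * c) * (p * q' - q * p')" by algebra
  then show ?thesis using assms by simp
qed

lemma cone_value_adjacent:
  assumes "p * q' - q * p' = 1"
  shows "cone_value p q p' q' (- 1)"
  unfolding cone_value_def
proof (intro exI[of _ "{(p, q), (p', q')}"] conjI allI impI)
  show "(0, 0) \<notin> {(p, q), (p', q')}" using assms by auto
  fix a b c d :: int
  assume "a * d - b * c = 1"
    "0 < a * p + b * q \<and> 0 < a * p' + b * q' \<or>
       (\<forall>(m, n) \<in> {(p, q), (p', q')}. a * m + b * n \<noteq> 0)"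
  then show "cone_defect (a * p + b * q) (c * p + d * q) (a * p' + b * q') (c * p' + d * q') = - 1"
    by (intro cone_defect_adjacent) (auto simp: transformed_det assms)
qed simp

lemma cone_value_split:
  fixes d e :: int
  assumes "p * n - q * m = 1" "m * q' - n * p' = e" "p * q' - q * p' = d" "0 < d" "0 < e"
    and K: "cone_value m n p' q' K"
  shows "cone_value p q p' q' (K - 1 + (d - e - 1)\<^sup>2 / (d * e))"
proof -
  obtain W where W: "finite W" "(0, 0) \<notin> W" and
    KW: "\<And>a b c d. a * d - b * c = 1 \<Longrightarrow>
          0 < a * m + b * n \<and> 0 < a * p' + b * q' \<or> (\<forall>(m, n) \<in> W. a * m + b * n \<noteq> 0) \<Longrightarrow>
          cone_defect (a * m + b * n) (c * m + d * n) (a * p' + b * q') (c * p' + d * q') = K"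
    using K unfolding cone_value_def by blast
  show ?thesis
    unfolding cone_value_def
  proof (intro exI[of _ "W \<union> {(p, q), (p', q'), (m, n)}"] conjI allI impI)
    show "finite (W \<union> {(p, q), (p', q'), (m, n)})" using W by simp
    show "(0, 0) \<notin> W \<union> {(p, q), (p', q'), (m, n)}" using W assms(1,3,4) by auto
    fix a b c r :: int
    assume abcr: "a * r - b * c = 1"
      and *: "0 < a * p + b * q \<and> 0 < a * p' + b * q' \<or>
       (\<forall>(i, j) \<in> W \<union> {(p, q), (p', q'), (m, n)}. a * i + b * j \<noteq> 0)"
    have "d * m = p' + e * p" "d * n = q' + e * q"
      using assms(1,2,3) by algebra+
    then have "d * (a * m + b * n) = (a * p' + b * q') + e * (a * p + b * q)" by algebra
    then have "0 < a * p + b * q \<Longrightarrow> 0 < a * p' + b * q' \<Longrightarrow> 0 < a * m + b * n"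
      using assms(4,5) by (metis add_pos_pos mult_pos_pos zero_less_mult_pos)
    then have **: "0 < a * m + b * n \<and> 0 < a * p' + b * q' \<or> (\<forall>(m, n) \<in> W. a * m + b * n \<noteq> 0)"
      and nz: "a * p + b * q \<noteq> 0" "a * p' + b * q' \<noteq> 0" "a * m + b * n \<noteq> 0"
      using * by auto
    have "cone_defect (a * m + b * n) (c * m + r * n) (a * p' + b * q') (c * p' + r * q') = K"
      using KW abcr ** by blast
    moreover have "cone_defect (a * p + b * q) (c * p + r * q) (a * p' + b * q') (c * p' + r * q')
       = cone_defect (a * m + b * n) (c * m + r * n) (a * p' + b * q') (c * p' + r * q') - 1
         + (d - e - 1)\<^sup>2 / (d * e)"
      by (rule cone_defect_split) (use nz assms(1-5) in \<open>simp_all add: transformed_det[OF abcr]\<close>)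
    ultimately show "cone_defect (a * p + b * q) (c * p + r * q) (a * p' + b * q') (c * p' + r * q')
       = K - 1 + (d - e - 1)\<^sup>2 / (d * e)" by simp
  qed
qed

lemma coprime_if_det_1:
  fixes p q p' q' :: int
  assumes "p * q' - q * p' = 1"
  shows "coprime p q" "coprime p' q'"
proof -
  show "coprime p q"
  proof (rule coprimeI)
    fix c assume "c dvd p" "c dvd q"
    then have "c dvd p * q' - q * p'" by (meson dvd_diff dvd_mult2)
    then show "is_unit c" using assms by simp
  qed
  show "coprime p' q'"
  proof (rule coprimeI)
    fix c assume "c dvd p'" "c dvd q'"
    then have "c dvd p * q' - q * p'" by (meson dvd_diff dvd_mult)
    then show "is_unit c" using assms by simp
  qed
qed

text \<open>
  The vectors that form a basis with \<open>(p, q)\<close> differ by multiples of \<open>(p, q)\<close>, and one of them has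
  a determinant with \<open>(p', q')\<close> that is reduced modulo the determinant of the cone. It is
  not zero, since otherwise \<open>(p', q')\<close> would be a proper multiple of that vector.
\<close>

lemma adjacent_in_cone:
  fixes p q p' q' :: int
  assumes "coprime p q" "coprime p' q'" "1 < p * q' - q * p'"
  obtains m n where "p * n - q * m = 1" "0 < m * q' - n * p'" "m * q' - n * p' < p * q' - q * p'"
proof -
  define d where "d = p * q' - q * p'"
  obtain a b where ab: "a * p + b * q = 1"
    using assms(1) by (metis bezout_int coprime_iff_gcd_eq_1)
  define e where "e = - b * q' - a * p'"
  define m where "m = - b - (e div d) * p"
  define n where "n = a - (e div d) * q"
  have "m * q' - n * p' = e - (e div d) * d"
    unfolding m_def n_def e_def d_def by (simp add: algebra_simps)
  also have "\<dots> = e mod d" by (simp add: minus_div_mult_eq_mod)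
  finally have e: "m * q' - n * p' = e mod d" .
  have det: "p * n - q * m = 1"
    unfolding m_def n_def using ab by (simp add: algebra_simps)
  have "e mod d \<noteq> 0"
  proof
    assume 0: "e mod d = 0"
    have "d * m = p'" "d * n = q'"
      using e det 0 unfolding d_def by algebra+
    then have "d dvd p'" "d dvd q'" by auto
    then have "is_unit d" using assms(2) by (metis coprime_common_divisor)
    then show False using assms(3) by (simp add: d_def[symmetric])
  qed
  moreover have "0 \<le> e mod d" "e mod d < d"
    using assms(3) by (simp_all add: d_def)
  ultimately show ?thesis
    using that[OF det] e by (simp add: d_def)
qed

text \<open>
  Cutting off a unimodular cone reduces the determinant, so by induction the value of a cone is
  determined by the sequence of determinants \<open>d > e > \<dots> \<ge> 1\<close> that occur, of which there are finitely
  many.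
\<close>

lemma finite_cone_values:
  "\<exists>V. finite V \<and> (\<forall>p q p' q'. coprime p q \<longrightarrow> coprime p' q' \<longrightarrow> 0 < p * q' - q * p' \<longrightarrow>
      p * q' - q * p' \<le> int D \<longrightarrow> (\<exists>K\<in>V. cone_value p q p' q' K))"
proof (induction D)
  case 0
  then show ?case by (intro exI[of _ "{}"]) auto
next
  case (Suc D)
  then obtain V where V: "finite V" "\<And>p q p' q'. coprime p q \<Longrightarrow> coprime p' q' \<Longrightarrow>
      0 < p * q' - q * p' \<Longrightarrow> p * q' - q * p' \<le> int D \<Longrightarrow> \<exists>K\<in>V. cone_value p q p' q' K"
    by blast
  define d where "d = int (Suc D)"
  define V' where "V' = insert (- 1)
    (V \<union> (\<lambda>(K, e). K - 1 + (d - e - 1)\<^sup>2 / (d * e)) ` (V \<times> {1..int D}))"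
  have "finite V'" using V by (simp add: V'_def)
  moreover have "\<exists>K\<in>V'. cone_value p q p' q' K"
    if *: "coprime p q" "coprime p' q'" "0 < p * q' - q * p'" "p * q' - q * p' \<le> d" for p q p' q'
  proof -
    consider "p * q' - q * p' \<le> int D" | "p * q' - q * p' = 1" | "1 < p * q' - q * p'" "p * q' - q * p' = d"
      using * unfolding d_def by linarith
    then show ?thesis
    proof cases
      case 1
      then show ?thesis using V(2)[of p q p' q'] * unfolding V'_def by blast
    next
      case 2
      then show ?thesis using cone_value_adjacent[of p q' q p'] unfolding V'_def by blast
    next
      case 3
      then obtain m n where mn: "p * n - q * m = 1" "0 < m * q' - n * p'"
          "m * q' - n * p' < p * q' - q * p'"
        using adjacent_in_cone * by blast
      define e where "e = m * q' - n * p'"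
      have e: "0 < e" "e \<le> int D"
        using mn 3(2) unfolding e_def d_def by auto
      moreover have "coprime m n" using coprime_if_det_1[OF mn(1)] by simp
      ultimately obtain K where K: "K \<in> V" "cone_value m n p' q' K"
        using V(2)[of m n p' q'] * unfolding e_def by blast
      have "cone_value p q p' q' (K - 1 + (d - e - 1)\<^sup>2 / (d * e))"
        by (rule cone_value_split[OF mn(1) e_def[symmetric] 3(2) _ e(1) K(2)]) (simp add: d_def)
      moreover have "K - 1 + (d - e - 1)\<^sup>2 / (d * e) \<in> V'"
        unfolding V'_def using K e by (intro insertI2 UnI2 image_eqI[where x="(K, e)"]) auto
      ultimately show ?thesis by blast
    qed
  qed
  ultimately show ?case unfolding d_def by (intro exI[of _ V']) blast
qed

text \<open>
  In coordinates in which the direction \<open>(i, j)\<close> is vertical, both spanning vectors have first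
  coordinate \<open>r\<close>, so the contribution to the dual area is zero, and they differ by the shear
  of \<open>rademacher_shift\<close>.
\<close>

lemma cone_value_full_width:
  fixes p q i j r :: int
  assumes "coprime p q" "coprime i j" "p * j - q * i = r" "0 < r"
  shows "cone_value p q (p + r * i) (q + r * j) (- 1)"
proof -
  have r: "p * (q + r * j) - q * (p + r * i) = r * r"
    unfolding assms(3)[symmetric] by algebra
  have cop: "coprime (p + r * i) (q + r * j)"
  proof (rule coprimeI)
    fix c assume c: "c dvd p + r * i" "c dvd q + r * j"
    have "c dvd (p + r * i) * j - (q + r * j) * i" using c by (meson dvd_diff dvd_mult2)
    moreover have "(p + r * i) * j - (q + r * j) * i = p * j - q * i" by algebra
    ultimately have "c dvd r" using assms(3) by simp
    then have "c dvd p" "c dvd q" using c by (metis dvd_add_left_iff dvd_mult2)+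
    then show "is_unit c" using assms(1) by (metis coprime_common_divisor)
  qed
  \<comment> \<open>Some value exists for this cone; it is then computed in one suitable coordinate system.\<close>
  obtain V where V: "\<And>p q p' q'. coprime p q \<Longrightarrow> coprime p' q' \<Longrightarrow> 0 < p * q' - q * p' \<Longrightarrow>
      p * q' - q * p' \<le> int (nat (r * r)) \<Longrightarrow> (\<exists>K\<in>V. cone_value p q p' q' K)"
    using finite_cone_values[of "nat (r * r)"] by blast
  obtain K where K: "cone_value p q (p + r * i) (q + r * j) K"
    using V[OF assms(1) cop] assms(4) unfolding r by auto
  obtain c d where cd: "c * i + d * j = 1"
    using assms(2) by (metis bezout_int coprime_iff_gcd_eq_1)
  define s where "s = c * p + d * q"
  have "j * (p + r * i) + (- i) * (q + r * j) = p * j - q * i"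
    "c * (p + r * i) + d * (q + r * j) = s + r * (c * i + d * j)"
    unfolding s_def by algebra+
  then have x: "j * p + (- i) * q = r" "j * (p + r * i) + (- i) * (q + r * j) = r"
    "c * (p + r * i) + d * (q + r * j) = s + r"
    using assms(3) cd by (simp_all add: algebra_simps)
  have "cone_defect (j * p + (- i) * q) (c * p + d * q)
     (j * (p + r * i) + (- i) * (q + r * j)) (c * (p + r * i) + d * (q + r * j)) = K"
  proof -
    have "j * d - (- i) * c = 1" using cd by (simp add: algebra_simps)
    moreover have "0 < j * p + (- i) * q \<and> 0 < j * (p + r * i) + (- i) * (q + r * j)"
      unfolding x using assms by simp
    ultimately show ?thesis using K unfolding cone_value_def by blast
  qed
  then have "K = cone_defect r s r (s + r)"
    unfolding x(1,2,3) s_def[symmetric] by simp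
  also have "\<dots> = - 1"
  proof -
    have "coprime r s"
    proof (rule coprimeI)
      fix k assume k: "k dvd r" "k dvd s"
      have "p = d * r + i * s" "q = - c * r + j * s"
        using cd unfolding s_def assms(3)[symmetric] by algebra+
      then have "k dvd p" "k dvd q" using k by (metis dvd_add dvd_mult)+
      then show "is_unit k" using assms(1) by (metis coprime_common_divisor)
    qed
    moreover have "\<not> r * r < 0" by (simp add: not_less)
    ultimately show ?thesis
      using assms(4) by (simp add: cone_defect_def even_rademacher_def rademacher_shift)
  qed
  finally show ?thesis using K by simp
qed

section \<open>Plane geometry\<close>

definition det2 :: "real^2 \<Rightarrow> real^2 \<Rightarrow> real" where
  "det2 u v = u $ 1 * v $ 2 - u $ 2 * v $ 1"

lemma det2_simps [simp]:
  "det2 (u + v) w = det2 u w + det2 v w" "det2 u (v + w) = det2 u v + det2 u w"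
  "det2 (u - v) w = det2 u w - det2 v w" "det2 u (v - w) = det2 u v - det2 u w"
  "det2 (c *\<^sub>R u) v = c * det2 u v" "det2 u (c *\<^sub>R v) = c * det2 u v"
  "det2 u u = 0" "det2 0 u = 0" "det2 u 0 = 0"
  "det2 (- u) v = - det2 u v" "det2 u (- v) = - det2 u v"
  by (simp_all add: det2_def algebra_simps)

lemma det2_swap: "det2 v u = - det2 u v"
  by (simp add: det2_def)

lemma inner_2: "(u :: real^2) \<bullet> v = u $ 1 * v $ 1 + u $ 2 * v $ 2"
  by (simp add: inner_vec_def UNIV_2)

lemma vec2_eq_iff: "(u :: real^2) = v \<longleftrightarrow> u $ 1 = v $ 1 \<and> u $ 2 = v $ 2"
  by (simp add: vec_eq_iff forall_2)

lemma det2_eq_0_if: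
  assumes "det2 u v \<noteq> 0" "det2 u z = 0" "det2 v z = 0"
  shows "z = 0"
proof -
  have "det2 u v * z $ 1 = det2 u z * v $ 1 - det2 v z * u $ 1"
    "det2 u v * z $ 2 = det2 u z * v $ 2 - det2 v z * u $ 2"
    by (simp_all add: det2_def algebra_simps)
  then show ?thesis using assms by (simp add: vec2_eq_iff)
qed

text \<open>
  The linear form with value 1 on \<open>a\<close> and on \<open>b\<close>; its negative is the vertex of the dual polygon that
  belongs to the edge from \<open>a\<close> to \<open>b\<close>.
\<close>

definition edge_functional :: "real^2 \<Rightarrow> real^2 \<Rightarrow> real^2" where
  "edge_functional a b = (1 / det2 a b) *\<^sub>R vector [b $ 2 - a $ 2, a $ 1 - b $ 1]"

lemma edge_functional_inner: "edge_functional a b \<bullet> z = det2 z (b - a) / det2 a b"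
  by (simp add: edge_functional_def inner_2 det2_def algebra_simps add_divide_distrib diff_divide_distrib)

lemma functional_unique:
  fixes l :: "real^2"
  assumes "l \<bullet> a = 1" "l \<bullet> b = 1" "det2 a b \<noteq> 0"
  shows "l = edge_functional a b"
proof -
  have "det2 a b * l $ 1 = (l \<bullet> a) * b $ 2 - (l \<bullet> b) * a $ 2"
    "det2 a b * l $ 2 = (l \<bullet> b) * a $ 1 - (l \<bullet> a) * b $ 1"
    by (simp_all add: det2_def inner_2 algebra_simps)
  then show ?thesis using assms
    by (simp add: vec2_eq_iff edge_functional_def field_simps)
qed

lemma det2_nonzero_if_level:
  fixes l :: "real^2"
  assumes "l \<bullet> a = 1" "l \<bullet> b = 1" "a \<noteq> b"
  shows "det2 a b \<noteq> 0"
proof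
  assume 0: "det2 a b = 0"
  have "(l \<bullet> a) * b $ 1 - (l \<bullet> b) * a $ 1 = - (l $ 2) * det2 a b"
    "(l \<bullet> a) * b $ 2 - (l \<bullet> b) * a $ 2 = l $ 1 * det2 a b"
    by (simp_all add: det2_def inner_2 algebra_simps)
  then show False using assms 0 by (simp add: vec2_eq_iff)
qed

text \<open>
  The endpoints of a segment whose line misses the origin, in counterclockwise order.
\<close>

definition ends :: "(real^2) set \<Rightarrow> (real^2) \<times> (real^2)" where
  "ends E = (SOME (a, b). E = closed_segment a b \<and> 0 < det2 a b)"

definition src :: "(real^2) set \<Rightarrow> real^2" where "src E = fst (ends E)"
definition tgt :: "(real^2) set \<Rightarrow> real^2" where "tgt E = snd (ends E)"

lemma src_tgt:
  assumes "s = closed_segment a b" "0 < det2 a b"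
  shows "src s = a" "tgt s = b"
proof -
  have "case ends s of (a, b) \<Rightarrow> s = closed_segment a b \<and> 0 < det2 a b"
    unfolding ends_def by (rule someI_ex) (use assms in auto)
  then have *: "s = closed_segment (src s) (tgt s)" "0 < det2 (src s) (tgt s)"
    by (auto simp: src_def tgt_def case_prod_unfold)
  then have "{src s, tgt s} = {a, b}" using assms(1) closed_segment_eq by metis
  then show "src s = a" "tgt s = b"
    using *(2) assms(2) det2_swap[of a b] by (auto simp: doubleton_eq_iff)
qed

lemma det2_edge_functionals:
  assumes "det2 a v \<noteq> 0" "det2 v b \<noteq> 0"
  shows "det2 (edge_functional a v) (edge_functional v b) = det2 (v - a) (b - v) / (det2 a v * det2 v b)"
proof -
  have "det2 (vector [v $ 2 - a $ 2, a $ 1 - v $ 1]) (vector [b $ 2 - v $ 2, v $ 1 - b $ 1])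
      = det2 (v - a) (b - v)"
    by (simp add: det2_def algebra_simps)
  then show ?thesis unfolding edge_functional_def by simp
qed

lemma det2_edge_functional_right:
  "det2 u (edge_functional a b) = - (u \<bullet> (b - a)) / det2 a b"
proof -
  have "det2 u (vector [b $ 2 - a $ 2, a $ 1 - b $ 1]) = - (u \<bullet> (b - a))"
    by (simp add: det2_def inner_2 algebra_simps)
  then show ?thesis unfolding edge_functional_def by simp
qed

text \<open>
  Twice the area of the triangle of the dual polygon at the vertex \<open>v\<close> is split into a
  contribution of each of the two edges at \<open>v\<close>, at the expense of the auxiliary linear form \<open>X\<close>. It
  rests on the linear relation between the three vectors \<open>a\<close>, \<open>v\<close>, \<open>b\<close>.
\<close>

lemma corner_area:
  fixes \<alpha> \<beta> :: real and a v b :: "real^2"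
  defines "X \<equiv> \<lambda>z. \<alpha> * z $ 1 + \<beta> * z $ 2"
  assumes "det2 a v \<noteq> 0" "det2 v b \<noteq> 0" "X v \<noteq> 0"
  shows "det2 (v - a) (b - v) / (det2 a v * det2 v b)
       = (1 - X a / X v) / det2 a v + (1 - X b / X v) / det2 v b"
proof -
  have "X v * det2 a b = X a * det2 v b + X b * det2 a v"
    by (simp add: X_def det2_def algebra_simps)
  then have "det2 a b = (X a * det2 v b + X b * det2 a v) / X v"
    using assms(4) by (simp add: field_simps)
  moreover have "det2 (v - a) (b - v) = det2 v b + det2 a v - det2 a b" by simp
  ultimately have 1: "det2 (v - a) (b - v)
      = det2 v b * (1 - X a / X v) + det2 a v * (1 - X b / X v)"
    by (simp add: add_divide_distrib algebra_simps)
  show ?thesis unfolding 1 using assms(2,3) by (simp add: add_divide_distrib)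
qed

section \<open>Polygons around the origin\<close>

locale polygon_around_origin =
  fixes P :: "(real^2) set"
  assumes polytope: "polytope P" and origin: "0 \<in> interior P"
begin

lemma aff_dim_P: "aff_dim P = 2"
  using origin aff_dim_nonempty_interior[of P] by auto

lemma compact_P: "compact P" and convex_P: "convex P" and polyhedron_P: "polyhedron P"
  using polytope by (simp_all add: polytope_imp_compact polytope_imp_convex polytope_imp_polyhedron)

lemma facet_iff_edge: "F facet_of P \<longleftrightarrow> F edge_of P"
  by (auto simp: facet_of_def edge_of_def aff_dim_P)

definition edges :: "(real^2) set set" where "edges = {E. E edge_of P}"

lemma finite_edges: "finite edges"
  unfolding edges_def edge_of_def using finite_polytope_faces[OF polytope]
  by (rule rev_finite_subset) auto

lemma supporting_functional:
  assumes "E \<in> edges"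
  obtains l where "E = {z \<in> P. l \<bullet> z = 1}" "\<And>z. z \<in> P \<Longrightarrow> l \<bullet> z \<le> 1"
proof -
  have "E face_of P" and dim: "aff_dim E = 1" using assms by (auto simp: edges_def edge_of_def)
  then have "E exposed_face_of P"
    using exposed_face_of_polyhedron[OF polyhedron_P] by simp
  then obtain a b where ab: "P \<subseteq> {x. a \<bullet> x \<le> b}" "E = P \<inter> {x. a \<bullet> x = b}"
    by (auto simp: exposed_face_of_def)
  have "a \<noteq> 0"
  proof
    assume "a = 0"
    then have "E = P \<or> E = {}" using ab by auto
    then show False using dim aff_dim_P by auto
  qed
  have "0 < b"
  proof -
    have "0 \<in> interior {x. a \<bullet> x \<le> b}"
      using origin ab(1) interior_mono by blast
    then show ?thesis using \<open>a \<noteq> 0\<close> by (simp add: interior_halfspace_le)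
  qed
  then show ?thesis
    using ab by (intro that[of "(1 / b) *\<^sub>R a"]) (auto simp: field_simps)
qed

lemma edge_is_segment:
  assumes "E \<in> edges"
  shows "\<exists>a b. E = closed_segment a b \<and> 0 < det2 a b"
proof -
  have "E face_of P" and dim: "aff_dim E = 1" using assms by (auto simp: edges_def edge_of_def)
  have "compact E" "convex E"
    using \<open>E face_of P\<close> compact_P convex_P face_of_imp_compact face_of_imp_convex by blast+
  moreover have "collinear E" "E \<noteq> {}" using dim by (auto simp: collinear_aff_dim)
  ultimately obtain a b where ab: "E = closed_segment a b"
    using compact_convex_collinear_segment by blast
  obtain l where l: "E = {z \<in> P. l \<bullet> z = 1}" using supporting_functional[OF assms] by blast
  have "a \<noteq> b" using dim ab by auto
  then have "det2 a b \<noteq> 0"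
    using l ab by (intro det2_nonzero_if_level[of l]) auto
  then consider "0 < det2 a b" | "0 < det2 b a"
    using det2_swap[of b a] by linarith
  then show ?thesis using ab closed_segment_commute by metis
qed

lemma edge_ends:
  assumes "E \<in> edges"
  shows "E = closed_segment (src E) (tgt E)" "0 < det2 (src E) (tgt E)"
  using edge_is_segment[OF assms] src_tgt by metis+

lemma edge_ends_extreme:
  assumes "E \<in> edges" "x \<in> E"
  shows "x extreme_point_of P \<longleftrightarrow> x = src E \<or> x = tgt E"
proof -
  have "E face_of P" using assms by (auto simp: edges_def edge_of_def)
  then have "x extreme_point_of P \<longleftrightarrow> x extreme_point_of E"
    using assms(2) extreme_point_of_face by blast
  then show ?thesis using edge_ends[OF assms(1)] extreme_point_of_segment by metis
qed

lemma ends_in_edge: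
  assumes "E \<in> edges" shows "src E \<in> E" "tgt E \<in> E" "src E \<in> P" "tgt E \<in> P"
    "src E extreme_point_of P" "tgt E extreme_point_of P"
proof -
  show 1: "src E \<in> E" "tgt E \<in> E"
    by (subst edge_ends(1)[OF assms], simp)+
  show "src E \<in> P" "tgt E \<in> P"
    using 1 assms edge_of_imp_subset by (auto simp: edges_def)
  show "src E extreme_point_of P" "tgt E extreme_point_of P"
    using 1 edge_ends_extreme[OF assms] by auto
qed

definition functional :: "(real^2) set \<Rightarrow> real^2" where
  "functional E = edge_functional (src E) (tgt E)"

lemma functional:
  assumes "E \<in> edges"
  shows "E = {z \<in> P. functional E \<bullet> z = 1}" "z \<in> P \<Longrightarrow> functional E \<bullet> z \<le> 1"
proof -
  obtain l where l: "E = {z \<in> P. l \<bullet> z = 1}" "\<And>z. z \<in> P \<Longrightarrow> l \<bullet> z \<le> 1"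
    using supporting_functional[OF assms] by blast
  have "l = functional E" unfolding functional_def
    using ends_in_edge[OF assms] edge_ends[OF assms] l(1)
    by (intro functional_unique) auto
  then show "E = {z \<in> P. functional E \<bullet> z = 1}" "z \<in> P \<Longrightarrow> functional E \<bullet> z \<le> 1"
    using l by auto
qed

lemma functional_on_edge: "E \<in> edges \<Longrightarrow> z \<in> E \<Longrightarrow> functional E \<bullet> z = 1"
  using functional(1) by blast

lemma edge_subset: "E \<in> edges \<Longrightarrow> E \<subseteq> P"
  using functional(1) by blast

lemma edges_eqI:
  assumes "E \<in> edges" "E' \<in> edges" "a \<in> E \<inter> E'" "b \<in> E \<inter> E'" "a \<noteq> b"
  shows "E = E'"
proof -
  have "det2 a b \<noteq> 0"
    using assms functional_on_edge by (intro det2_nonzero_if_level[of "functional E"]) auto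
  then have "functional E = edge_functional a b" "functional E' = edge_functional a b"
    using assms functional_on_edge by (auto intro!: functional_unique)
  then show ?thesis using functional(1)[OF assms(1)] functional(1)[OF assms(2)] by simp
qed

text \<open>
  A face that contains an interior point of a segment in \<open>P\<close> contains the segment.
\<close>

lemma edges_meeting_inside_eq:
  assumes "E \<in> edges" "E' \<in> edges" "a \<in> E" "b \<in> E" "z \<in> open_segment a b" "z \<in> E'"
  shows "E = E'"
proof -
  have "E' face_of P" using assms by (auto simp: edges_def edge_of_def)
  then have "a \<in> E' \<and> b \<in> E'" using assms edge_subset unfolding face_of_def by blast
  moreover have "a \<noteq> b" using assms(5) by auto
  ultimately show ?thesis using edges_eqI[of E E' a b] assms by auto
qed

lemma ray_meets_boundary_once:
  assumes "E \<in> edges" "E' \<in> edges" "z \<in> E" "c *\<^sub>R z \<in> E'" "0 < c"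
  shows "c = 1"
proof -
  have "functional E \<bullet> (c *\<^sub>R z) \<le> 1" "functional E' \<bullet> z \<le> 1"
    using assms edge_subset functional(2) by blast+
  moreover have "functional E \<bullet> z = 1" "functional E' \<bullet> (c *\<^sub>R z) = 1"
    using assms functional_on_edge by blast+
  ultimately have "c \<le> 1" "c * (functional E' \<bullet> z) = 1" "functional E' \<bullet> z \<le> 1" by auto
  moreover have "c * (functional E' \<bullet> z) \<le> c * 1"
    using assms(5) calculation by (intro mult_left_mono) auto
  ultimately show ?thesis by linarith
qed

definition vertices :: "(real^2) set" where "vertices = {v. v extreme_point_of P}"

text \<open>
  If two edges start at \<open>v\<close> and end at \<open>w\<close> and \<open>w'\<close>, each of these points lies on the inner side
  of the other edge. Adding both inequalities gives an equality, so that \<open>w'\<close> lies on the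
  first edge.
\<close>

lemma inj_on_src: "inj_on src edges"
proof (rule inj_onI)
  fix E E' assume E: "E \<in> edges" "E' \<in> edges" and eq: "src E = src E'"
  let ?v = "src E" let ?w = "tgt E" let ?w' = "tgt E'"
  have d: "0 < det2 ?v ?w" "0 < det2 ?v ?w'" using edge_ends E eq by metis+
  have "functional E \<bullet> ?w' \<le> 1" "functional E' \<bullet> ?w \<le> 1"
    using functional(2) ends_in_edge E by auto
  then have "det2 ?w' ?w - det2 ?w' ?v \<le> det2 ?v ?w" "det2 ?w ?w' - det2 ?w ?v \<le> det2 ?v ?w'"
    using d by (simp_all add: functional_def edge_functional_inner eq[symmetric])
  then have "functional E \<bullet> ?w' = 1"
    using d by (simp add: functional_def edge_functional_inner det2_swap[of ?w' ?w]
        det2_swap[of ?w' ?v] det2_swap[of ?w ?v])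
  then have "?w' \<in> E" using functional(1)[OF E(1)] ends_in_edge E by blast
  moreover have "?v \<noteq> ?w'" using d by auto
  ultimately show "E = E'"
    using edges_eqI[OF E, of ?v ?w'] ends_in_edge[OF E(1)] ends_in_edge[OF E(2)] eq by auto
qed

lemma inj_on_tgt: "inj_on tgt edges"
proof (rule inj_onI)
  fix E E' assume E: "E \<in> edges" "E' \<in> edges" and eq: "tgt E = tgt E'"
  let ?v = "tgt E" let ?w = "src E" let ?w' = "src E'"
  have d: "0 < det2 ?w ?v" "0 < det2 ?w' ?v" using edge_ends E eq by metis+
  have "functional E \<bullet> ?w' \<le> 1" "functional E' \<bullet> ?w \<le> 1"
    using functional(2) ends_in_edge E by auto
  then have "det2 ?w' ?v - det2 ?w' ?w \<le> det2 ?w ?v" "det2 ?w ?v - det2 ?w ?w' \<le> det2 ?w' ?v"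
    using d by (simp_all add: functional_def edge_functional_inner eq[symmetric])
  then have "functional E \<bullet> ?w' = 1"
    using d by (simp add: functional_def edge_functional_inner det2_swap[of ?w' ?w])
  then have "?w' \<in> E" using functional(1)[OF E(1)] ends_in_edge E by blast
  moreover have "?v \<noteq> ?w'" using d by auto
  ultimately show "E = E'"
    using edges_eqI[OF E, of ?v ?w'] ends_in_edge[OF E(1)] ends_in_edge[OF E(2)] eq by auto
qed

text \<open>
  A vertex is the intersection of the facets through it, and these are edges; a single edge
  would be too large.
\<close>

lemma vertex_on_two_edges:
  assumes "v \<in> vertices"
  obtains E E' where "E \<in> edges" "E' \<in> edges" "E \<noteq> E'" "v \<in> E" "v \<in> E'"
proof -
  have "{v} face_of P" using assms by (simp add: vertices_def face_of_singleton)
  moreover have "{v} \<noteq> P" using aff_dim_P by auto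
  ultimately have "{v} = \<Inter>{F. F facet_of P \<and> {v} \<subseteq> F}"
    using face_of_polyhedron[OF polyhedron_P] by blast
  then have v: "{v} = \<Inter>{E \<in> edges. v \<in> E}"
    unfolding facet_iff_edge edges_def by simp
  moreover have "v + axis 1 1 \<notin> {v}" by (simp add: axis_eq_0_iff)
  ultimately have "{E \<in> edges. v \<in> E} \<noteq> {}" by (metis Inter_empty UNIV_I)
  then obtain E where E: "E \<in> edges" "v \<in> E" by blast
  then obtain x where x: "x \<in> E" "x \<noteq> v"
    using ends_in_edge[OF E(1)] edge_ends(2)[OF E(1)] by (metis det2_simps(7) less_irrefl)
  then have "x \<notin> \<Inter>{E \<in> edges. v \<in> E}" unfolding v[symmetric] by simp
  then obtain E' where "E' \<in> edges" "v \<in> E'" "x \<notin> E'" by blast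
  then show ?thesis using that[of E E'] E x by auto
qed

text \<open>
  Of the two edges at a vertex one starts there and one ends there. This replaces a cyclic
  enumeration of the vertices: sums over vertices and over edges can be exchanged.
\<close>

lemma bij_betw_src: "bij_betw src edges vertices" and bij_betw_tgt: "bij_betw tgt edges vertices"
proof -
  have "v \<in> src ` edges \<and> v \<in> tgt ` edges" if "v \<in> vertices" for v
  proof -
    obtain E E' where E: "E \<in> edges" "E' \<in> edges" "E \<noteq> E'" "v \<in> E" "v \<in> E'"
      using vertex_on_two_edges[OF \<open>v \<in> vertices\<close>] by blast
    then have "v = src E \<or> v = tgt E" "v = src E' \<or> v = tgt E'"
      using edge_ends_extreme that by (auto simp: vertices_def)
    then show ?thesis
      using E inj_on_src inj_on_tgt by (metis inj_onD imageI)
  qed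
  moreover have "src ` edges \<subseteq> vertices" "tgt ` edges \<subseteq> vertices"
    using ends_in_edge by (auto simp: vertices_def)
  ultimately show "bij_betw src edges vertices" "bij_betw tgt edges vertices"
    using inj_on_src inj_on_tgt unfolding bij_betw_def by blast+
qed

lemma finite_vertices: "finite vertices"
  using bij_betw_src finite_edges bij_betw_finite by blast

section \<open>The dual area as a sum over edges\<close>

text \<open>
  The linear forms in the dual polygon whose minimum over \<open>P\<close> is attained at \<open>v\<close> form the triangle
  between the origin and the dual vertices of the two edges at \<open>v\<close>.
\<close>

lemma corner:
  assumes E: "E \<in> edges" "E' \<in> edges" and v: "tgt E = v" "src E' = v"
  shows "0 < det2 (functional E) (functional E')"
    and "{u \<in> dual_polygon P. \<forall>z\<in>P. u \<bullet> v \<le> u \<bullet> z}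
           = convex hull {0, - functional E, - functional E'}" (is "?D = ?T")
proof -
  define a where "a = src E"
  define b where "b = tgt E'"
  define p where "p = functional E"
  define q where "q = functional E'"
  have d: "0 < det2 a v" "0 < det2 v b"
    using edge_ends(2)[OF E(1)] edge_ends(2)[OF E(2)] v by (simp_all add: a_def b_def)
  have p: "p = edge_functional a v" and q: "q = edge_functional v b"
    using v by (auto simp: p_def q_def functional_def a_def b_def)
  have vE: "v \<in> P" "v \<in> E" "v \<in> E'" "a \<in> E" "b \<in> E'" "a \<in> P" "b \<in> P" "a extreme_point_of P"
    using ends_in_edge[OF E(1)] ends_in_edge[OF E(2)] v by (auto simp: a_def b_def)
  have "a \<notin> E'"
    using edge_ends_extreme[OF E(2), of a] vE(8) d v(2) det2_swap[of a v] by (auto simp: b_def)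
  then have "q \<bullet> a < 1"
    using functional[OF E(2)] vE by (force simp: q_def)
  then have "det2 (v - a) (b - v) > 0"
    using d by (simp add: q edge_functional_inner)
  then have pos: "0 < det2 p q"
    unfolding p q using d by (subst det2_edge_functionals) auto
  then show "0 < det2 (functional E) (functional E')" by (simp add: p_def q_def)
  have pv: "p \<bullet> v = 1" "q \<bullet> v = 1"
    using functional_on_edge E vE by (auto simp: p_def q_def)
  have "?T = ?D"
  proof (intro set_eqI iffI)
    fix u assume "u \<in> ?T"
    then obtain \<alpha> \<beta> where ab: "0 \<le> \<alpha>" "0 \<le> \<beta>" "\<alpha> + \<beta> \<le> 1" and u: "u = - (\<alpha> *\<^sub>R p) - \<beta> *\<^sub>R q"
      by (auto simp: convex_hull_3 p_def q_def)
    have "u \<bullet> v = - (\<alpha> + \<beta>)" by (simp add: u inner_diff_left pv)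
    moreover have "- (\<alpha> + \<beta>) \<le> u \<bullet> z" if "z \<in> P" for z
    proof -
      have "\<alpha> * (p \<bullet> z) \<le> \<alpha> * 1" "\<beta> * (q \<bullet> z) \<le> \<beta> * 1"
        using functional(2)[OF E(1) that] functional(2)[OF E(2) that] ab
        by (intro mult_left_mono; simp add: p_def q_def)+
      then show ?thesis by (simp add: u inner_diff_left)
    qed
    ultimately show "u \<in> ?D" using ab by (force simp: dual_polygon_def)
  next
    fix u assume "u \<in> ?D"
    then have u: "-1 \<le> u \<bullet> v" "u \<bullet> v \<le> u \<bullet> a" "u \<bullet> v \<le> u \<bullet> b"
      using vE by (auto simp: dual_polygon_def)
    define \<alpha> where "\<alpha> = - det2 u q / det2 p q"
    define \<beta> where "\<beta> = det2 u p / det2 p q"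
    have "0 \<le> - det2 u q" "0 \<le> det2 u p"
      using u d by (simp_all add: p q det2_edge_functional_right inner_diff_right divide_nonpos_pos)
    then have ab: "0 \<le> \<alpha>" "0 \<le> \<beta>" using pos by (simp_all add: \<alpha>_def \<beta>_def divide_nonpos_pos)
    have eq: "u = - (\<alpha> *\<^sub>R p) - \<beta> *\<^sub>R q"
    proof -
      have "det2 p (u + \<alpha> *\<^sub>R p + \<beta> *\<^sub>R q) = 0" "det2 q (u + \<alpha> *\<^sub>R p + \<beta> *\<^sub>R q) = 0"
        using pos by (simp_all add: \<alpha>_def \<beta>_def det2_swap[of q p] det2_swap[of p u] det2_swap[of q u])
      then have "u + \<alpha> *\<^sub>R p + \<beta> *\<^sub>R q = 0" using pos det2_eq_0_if[of p q] by auto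
      then show ?thesis by (metis add.commute add_diff_cancel_left' add_eq_0_iff diff_0 diff_diff_add)
    qed
    have "u \<bullet> v = - (\<alpha> + \<beta>)" by (simp add: eq inner_diff_left pv)
    then have "\<alpha> + \<beta> \<le> 1" using u by simp
    then have "u = (1 - \<alpha> - \<beta>) *\<^sub>R 0 + \<alpha> *\<^sub>R - p + \<beta> *\<^sub>R - q"
      "0 \<le> 1 - \<alpha> - \<beta>" "(1 - \<alpha> - \<beta>) + \<alpha> + \<beta> = 1" by (simp_all add: eq)
    then show "u \<in> ?T" using ab unfolding convex_hull_3 p_def q_def by blast
  qed
  then show "?D = ?T" by simp
qed

lemma linear_min_at_vertex:
  fixes u :: "real^2"
  obtains v where "v \<in> vertices" "\<forall>z\<in>P. u \<bullet> v \<le> u \<bullet> z"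
proof -
  have P: "P = convex hull vertices"
    unfolding vertices_def by (rule Krein_Milman_Minkowski) (simp_all add: compact_P convex_P)
  have "vertices \<noteq> {}" using P aff_dim_P by auto
  then have "Min ((\<bullet>) u ` vertices) \<in> (\<bullet>) u ` vertices"
    using finite_vertices by (intro Min_in) auto
  then obtain v where v: "v \<in> vertices" "u \<bullet> v = Min ((\<bullet>) u ` vertices)" by force
  then have min: "u \<bullet> v \<le> u \<bullet> w" if "w \<in> vertices" for w
    using that finite_vertices by simp
  have "convex hull vertices \<subseteq> {z. u \<bullet> v \<le> u \<bullet> z}"
  proof (rule hull_minimal)
    show "vertices \<subseteq> {z. u \<bullet> v \<le> u \<bullet> z}" using min by blast
    show "convex {z. u \<bullet> v \<le> u \<bullet> z}" using convex_halfspace_ge[where a = u and b = "u \<bullet> v"] by simp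
  qed
  then have "P \<subseteq> {z. u \<bullet> v \<le> u \<bullet> z}" using P by metis
  then show ?thesis using v(1) that by blast
qed

definition in_edge where "in_edge = the_inv_into edges tgt"
definition out_edge where "out_edge = the_inv_into edges src"

lemma in_out_edge:
  assumes "v \<in> vertices"
  shows "in_edge v \<in> edges" "out_edge v \<in> edges" "tgt (in_edge v) = v" "src (out_edge v) = v"
  using bij_betw_src bij_betw_tgt assms unfolding in_edge_def out_edge_def bij_betw_def
  by (metis the_inv_into_into subset_refl, metis the_inv_into_into subset_refl,
      metis f_the_inv_into_f, metis f_the_inv_into_f)

text \<open>
  Every linear form attains its minimum over \<open>P\<close> at a vertex, and those that attain it at two given
  vertices lie on a line. So the triangles at the vertices cover the dual polygon and overlap in sets
  of measure zero.
\<close>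

lemma dual_area_corners:
  "dual_area P = (\<Sum>v\<in>vertices. det2 (functional (in_edge v)) (functional (out_edge v)))"
proof -
  define C where "C v = convex hull {0, - functional (in_edge v), - functional (out_edge v)}" for v
  have C: "C v = {u \<in> dual_polygon P. \<forall>z\<in>P. u \<bullet> v \<le> u \<bullet> z}" if "v \<in> vertices" for v
    using corner(2)[of "in_edge v" "out_edge v" v] in_out_edge[OF that] by (simp add: C_def)
  have "dual_polygon P = \<Union> (C ` vertices)"
  proof (intro set_eqI iffI)
    fix u assume "u \<in> dual_polygon P"
    obtain v where v: "v \<in> vertices" "\<forall>z\<in>P. u \<bullet> v \<le> u \<bullet> z"
      by (rule linear_min_at_vertex)
    with \<open>u \<in> dual_polygon P\<close> have "u \<in> C v" using C by simp
    then show "u \<in> \<Union> (C ` vertices)" using v by blast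
  qed (use C in auto)
  moreover have "measure lebesgue (\<Union> (C ` vertices)) = (\<Sum>v\<in>vertices. measure lebesgue (C v))"
  proof (rule measure_negligible_finite_Union_image[OF finite_vertices])
    show "C v \<in> lmeasurable" for v
      unfolding C_def by (intro lmeasurable_compact finite_imp_compact_convex_hull) simp
    show "pairwise (\<lambda>v w. negligible (C v \<inter> C w)) vertices"
    proof (rule pairwiseI)
      fix v w assume vw: "v \<in> vertices" "w \<in> vertices" "v \<noteq> w"
      then have "v \<in> P" "w \<in> P" by (auto simp: vertices_def extreme_point_of_def)
      have "C v \<inter> C w \<subseteq> {u. (v - w) \<bullet> u = 0}"
      proof
        fix u assume "u \<in> C v \<inter> C w"
        then have "u \<bullet> v \<le> u \<bullet> w" "u \<bullet> w \<le> u \<bullet> v"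
          using C vw(1,2) \<open>v \<in> P\<close> \<open>w \<in> P\<close> by auto
        then show "u \<in> {u. (v - w) \<bullet> u = 0}" by (simp add: inner_diff_left inner_commute[of _ u])
      qed
      then show "negligible (C v \<inter> C w)"
        using negligible_hyperplane[of "v - w" 0] vw negligible_subset by auto
    qed
  qed
  moreover have "2 * measure lebesgue (C v) = det2 (functional (in_edge v)) (functional (out_edge v))"
    if "v \<in> vertices" for v
  proof -
    have "compact (C v)" unfolding C_def by (intro finite_imp_compact_convex_hull) simp
    then have "measure lebesgue (C v) = measure lborel (C v)"
      by (intro measure_completion) (auto dest: compact_imp_closed)
    then show ?thesis
      using corner(1)[of "in_edge v" "out_edge v" v] in_out_edge[OF that]
      unfolding C_def content_triangle by (simp add: det2_def mult.commute)
  qed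
  ultimately show ?thesis unfolding dual_area_def by (simp add: sum_distrib_left)
qed

lemma dual_area_edges:
  fixes \<alpha> \<beta> :: real
  defines "X \<equiv> \<lambda>z. \<alpha> * z $ 1 + \<beta> * z $ 2"
  assumes nz: "\<And>v. v \<in> vertices \<Longrightarrow> X v \<noteq> 0"
  shows "dual_area P = (\<Sum>E\<in>edges.
     (2 - X (src E) / X (tgt E) - X (tgt E) / X (src E)) / det2 (src E) (tgt E))"
proof -
  let ?f = "\<lambda>E. (1 - X (src E) / X (tgt E)) / det2 (src E) (tgt E)"
  let ?g = "\<lambda>E. (1 - X (tgt E) / X (src E)) / det2 (src E) (tgt E)"
  have "det2 (functional (in_edge v)) (functional (out_edge v)) = ?f (in_edge v) + ?g (out_edge v)"
    if "v \<in> vertices" for v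
  proof -
    note [simp] = in_out_edge[OF that]
    have "det2 (src (in_edge v)) v \<noteq> 0" "det2 v (tgt (out_edge v)) \<noteq> 0"
      using edge_ends(2)[of "in_edge v"] edge_ends(2)[of "out_edge v"] by auto
    then show ?thesis
      using corner_area[of "src (in_edge v)" v "tgt (out_edge v)" \<alpha> \<beta>] nz[OF that]
      by (simp add: functional_def det2_edge_functionals X_def)
  qed
  then have "dual_area P = (\<Sum>v\<in>vertices. ?f (in_edge v)) + (\<Sum>v\<in>vertices. ?g (out_edge v))"
    by (simp add: dual_area_corners sum.distrib)
  also have "(\<Sum>v\<in>vertices. ?f (in_edge v)) = (\<Sum>E\<in>edges. ?f E)"
    unfolding in_edge_def by (rule sum.reindex_bij_betw) (rule bij_betw_the_inv_into[OF bij_betw_tgt])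
  also have "(\<Sum>v\<in>vertices. ?g (out_edge v)) = (\<Sum>E\<in>edges. ?g E)"
    unfolding out_edge_def by (rule sum.reindex_bij_betw) (rule bij_betw_the_inv_into[OF bij_betw_src])
  finally show ?thesis
    by (simp add: sum.distrib[symmetric] add_divide_distrib[symmetric] algebra_simps)
qed

lemma sum_edges_telescope:
  fixes f :: "real^2 \<Rightarrow> real"
  shows "(\<Sum>E\<in>edges. f (tgt E) - f (src E)) = 0"
  using sum.reindex_bij_betw[OF bij_betw_src, of f] sum.reindex_bij_betw[OF bij_betw_tgt, of f]
  by (simp add: sum_subtractf)

text \<open>
  An edge that runs from the negative to the positive side meets the ray in the direction
  \<open>\<zeta>\<close> of the line \<open>X = 0\<close>, always on the same side of the origin since the orientation is
  counterclockwise. That ray meets the boundary only once.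
\<close>

lemma upward_crossing_unique:
  fixes \<alpha> \<beta> :: real
  defines "X \<equiv> \<lambda>z. \<alpha> * z $ 1 + \<beta> * z $ 2"
  assumes E: "E \<in> edges" "E' \<in> edges"
    and "X (src E) < 0" "0 < X (tgt E)" "X (src E') < 0" "0 < X (tgt E')"
  shows "E = E'"
proof -
  define \<zeta> :: "real^2" where "\<zeta> = vector [\<beta>, - \<alpha>]"
  have "\<exists>z c. z \<in> open_segment (src E) (tgt E) \<and> 0 < c \<and> z = c *\<^sub>R \<zeta>"
    if E: "E \<in> edges" and s: "X (src E) < 0" "0 < X (tgt E)" for E
  proof -
    let ?a = "src E" and ?b = "tgt E"
    \<comment> \<open>the parameter at which the edge meets the line \<open>X = 0\<close>\<close>
    define t where "t = X ?a / (X ?a - X ?b)"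
    have t: "0 < t" "t < 1" using s by (simp_all add: t_def field_simps)
    define z where "z = (1 - t) *\<^sub>R ?a + t *\<^sub>R ?b"
    have "?a \<noteq> ?b" using s by auto
    then have "z \<in> open_segment ?a ?b"
      unfolding in_segment z_def using t by blast
    have "X z = (1 - t) * X ?a + t * X ?b"
      by (simp add: z_def X_def algebra_simps)
    also have "\<dots> = X ?a - t * (X ?a - X ?b)" by (simp add: algebra_simps)
    also have "\<dots> = 0" using s by (simp add: t_def)
    finally have Xz: "X z = 0" .
    have detz: "det2 z ?b = (1 - t) * det2 ?a ?b" by (simp add: z_def)
    have X: "det2 \<zeta> w = X w" for w by (simp add: det2_def \<zeta>_def X_def)
    define c where "c = det2 z ?b / X ?b"
    have "0 < c" using t edge_ends(2)[OF E] s unfolding c_def detz by simp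
    moreover have "z - c *\<^sub>R \<zeta> = 0"
      by (rule det2_eq_0_if[of \<zeta> ?b])
        (use s Xz in \<open>simp_all add: X c_def det2_swap[of ?b z] det2_swap[of ?b \<zeta>]\<close>)
    ultimately show ?thesis using \<open>z \<in> open_segment ?a ?b\<close> by auto
  qed
  then obtain z c z' c' where z: "z \<in> open_segment (src E) (tgt E)" "0 < c" "z = c *\<^sub>R \<zeta>"
     "z' \<in> open_segment (src E') (tgt E')" "0 < c'" "z' = c' *\<^sub>R \<zeta>"
    using assms by metis
  have zE: "z \<in> E" "z' \<in> E'"
    using z E edge_ends(1) open_closed_segment by metis+
  have "z' = (c' / c) *\<^sub>R z" using z by simp
  then have "z = z'" using ray_meets_boundary_once[OF E, of z "c' / c"] zE z by auto
  then show ?thesis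
    using edges_meeting_inside_eq[OF E, of "src E" "tgt E" z] ends_in_edge E z zE by auto
qed

lemma card_crossings:
  fixes \<alpha> \<beta> :: real
  defines "X \<equiv> \<lambda>z. \<alpha> * z $ 1 + \<beta> * z $ 2"
  shows "card {E \<in> edges. X (src E) * X (tgt E) < 0} \<le> 2"
proof -
  let ?U = "{E \<in> edges. X (src E) < 0 \<and> 0 < X (tgt E)}"
  let ?D = "{E \<in> edges. 0 < X (src E) \<and> X (tgt E) < 0}"
  have "{E \<in> edges. X (src E) * X (tgt E) < 0} = ?U \<union> ?D"
    by (auto simp: mult_less_0_iff)
  moreover have "card ?U \<le> Suc 0"
    using upward_crossing_unique[of _ _ \<alpha> \<beta>] finite_edges
    by (subst card_le_Suc0_iff_eq) (auto simp: X_def)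
  moreover have "card ?D \<le> Suc 0"
    using upward_crossing_unique[of _ _ "- \<alpha>" "- \<beta>"] finite_edges
    by (subst card_le_Suc0_iff_eq) (auto simp: X_def)
  ultimately show ?thesis using card_Un_le[of ?U ?D] by simp
qed

end

section \<open>Tilings of a segment\<close>

lemma interval_tiling_telescope:
  fixes f :: "real \<Rightarrow> real" and \<sigma> \<tau> :: "'a \<Rightarrow> real"
  assumes "finite I" and less: "\<And>i. i \<in> I \<Longrightarrow> \<sigma> i < \<tau> i"
    and union: "(\<Union>i\<in>I. {\<sigma> i..\<tau> i}) = {0..1}"
    and disj: "\<And>i j. i \<in> I \<Longrightarrow> j \<in> I \<Longrightarrow> i \<noteq> j \<Longrightarrow> {\<sigma> i<..<\<tau> i} \<inter> {\<sigma> j<..<\<tau> j} = {}"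
  shows "(\<Sum>i\<in>I. f (\<tau> i) - f (\<sigma> i)) = f 1 - f 0"
proof -
  let ?K = "\<lambda>i. (\<sigma> i, {\<sigma> i..\<tau> i})"
  have inj: "inj_on ?K I"
  proof (rule inj_onI, rule ccontr)
    fix i j assume ij: "i \<in> I" "j \<in> I" "?K i = ?K j" "i \<noteq> j"
    then have "\<sigma> i = \<sigma> j" "\<tau> i = \<tau> j" using less[OF ij(1)] less[OF ij(2)] by auto
    then show False using disj[OF ij(1,2,4)] less[OF ij(1)] by auto
  qed
  have "?K ` I tagged_division_of {0..1}"
    unfolding tagged_division_of_def tagged_partial_division_of_def
  proof (intro conjI allI impI)
    show "finite (?K ` I)" using assms by simp
    show "\<Union> {K. \<exists>x. (x, K) \<in> ?K ` I} = {0..1}"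
    proof -
      have "{K. \<exists>x. (x, K) \<in> ?K ` I} = (\<lambda>i. {\<sigma> i..\<tau> i}) ` I" by auto
      then show ?thesis using union by simp
    qed
  next
    fix x K assume "(x, K) \<in> ?K ` I"
    then obtain i where i: "i \<in> I" "x = \<sigma> i" "K = {\<sigma> i..\<tau> i}" by auto
    show "x \<in> K" "K \<subseteq> {0..1}" "\<exists>a b. K = cbox a b"
      using i less[OF i(1)] union by (auto simp del: atLeastatMost_subset_iff)
  next
    fix x K x' K'
    assume "(x, K) \<in> ?K ` I \<and> (x', K') \<in> ?K ` I \<and> (x, K) \<noteq> (x', K')"
    then obtain i j where i: "i \<in> I" "x = \<sigma> i" "K = {\<sigma> i..\<tau> i}"
      and j: "j \<in> I" "x' = \<sigma> j" "K' = {\<sigma> j..\<tau> j}" "i \<noteq> j" by auto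
    then show "interior K \<inter> interior K' = {}"
      using i disj[OF i(1) j(1,4)] by simp
  qed
  then have "(\<Sum>(x, K)\<in>?K ` I. f (Sup K) - f (Inf K)) = f 1 - f 0"
    by (intro additive_tagged_division_1) auto
  moreover have "(\<Sum>(x, K)\<in>?K ` I. f (Sup K) - f (Inf K)) = (\<Sum>i\<in>I. f (\<tau> i) - f (\<sigma> i))"
    unfolding sum.reindex[OF inj] by (rule sum.cong) (use less in \<open>auto simp: less_imp_le\<close>)
  ultimately show ?thesis by simp
qed

text \<open>
  The parameter interval of a tiled segment is tiled by the parameter intervals of the parts,
  which is a tagged division of the kind used for the gauge integral.
\<close>

lemma segment_tiling_telescope:
  fixes a b :: "real^2" and f :: "real \<Rightarrow> real"
  defines "\<gamma> \<equiv> \<lambda>t. a + t *\<^sub>R (b - a)"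
  assumes "finite S" "a \<noteq> b" and less: "\<And>s. s \<in> S \<Longrightarrow> \<sigma> s < \<tau> s"
    and seg: "\<And>s. s \<in> S \<Longrightarrow> s = closed_segment (\<gamma> (\<sigma> s)) (\<gamma> (\<tau> s))"
    and union: "\<Union>S = closed_segment a b"
    and disj: "pairwise (\<lambda>s t. disjnt (rel_interior s) (rel_interior t)) S"
  shows "(\<Sum>s\<in>S. f (\<tau> s) - f (\<sigma> s)) = f 1 - f 0"
proof -
  have inj: "inj \<gamma>" using \<open>a \<noteq> b\<close> by (auto simp: inj_def \<gamma>_def)
  have closed: "closed_segment (\<gamma> x) (\<gamma> y) = \<gamma> ` {x..y}" if "x \<le> y" for x y
  proof -
    have lin: "linear (\<lambda>t. t *\<^sub>R (b - a))" by (intro linearI) (auto simp: algebra_simps)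
    have "closed_segment (\<gamma> x) (\<gamma> y) = (+) a ` (\<lambda>t. t *\<^sub>R (b - a)) ` closed_segment x y"
      unfolding closed_segment_linear_image[OF lin, symmetric] \<gamma>_def
      by (rule closed_segment_translation)
    also have "\<dots> = \<gamma> ` closed_segment x y" by (simp add: image_image \<gamma>_def)
    finally have "closed_segment (\<gamma> x) (\<gamma> y) = \<gamma> ` closed_segment x y" .
    then show ?thesis using that by (simp add: closed_segment_eq_real_ivl)
  qed
  have open': "rel_interior (\<gamma> ` {x..y}) = \<gamma> ` {x<..<y}" if "x < y" for x y
  proof -
    have "rel_interior (\<gamma> ` {x..y}) = open_segment (\<gamma> x) (\<gamma> y)"
      using that inj closed[of x y] by (simp flip: closed add: rel_interior_closed_segment inj_eq)
    also have "\<dots> = \<gamma> ` {x..y} - \<gamma> ` {x, y}"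
      using closed[of x y] that by (simp add: open_segment_def)
    also have "\<dots> = \<gamma> ` ({x..y} - {x, y})" by (rule image_set_diff[OF inj, symmetric])
    also have "{x..y} - {x, y} = {x<..<y}" by auto
    finally show ?thesis .
  qed
  have s: "s = \<gamma> ` {\<sigma> s..\<tau> s}" if "s \<in> S" for s
    using seg[OF that] closed less[OF that] by simp
  show ?thesis
  proof (rule interval_tiling_telescope[OF \<open>finite S\<close> less])
    have "\<gamma> ` (\<Union>s\<in>S. {\<sigma> s..\<tau> s}) = (\<Union>s\<in>S. s)"
      unfolding image_UN by (intro SUP_cong refl s[symmetric])
    also have "\<dots> = \<gamma> ` {0..1}"
      using closed[of 0 1] union by (simp add: \<gamma>_def)
    finally show "(\<Union>s\<in>S. {\<sigma> s..\<tau> s}) = {0..1}"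
      by (simp only: inj_image_eq_iff[OF inj])
    fix s t assume st: "s \<in> S" "t \<in> S" "s \<noteq> t"
    then have "disjnt (rel_interior s) (rel_interior t)" using disj by (auto simp: pairwise_def)
    moreover have "rel_interior s = \<gamma> ` {\<sigma> s<..<\<tau> s}" "rel_interior t = \<gamma> ` {\<sigma> t<..<\<tau> t}"
      using s[OF st(1)] s[OF st(2)] open'[OF less[OF st(1)]] open'[OF less[OF st(2)]] by metis+
    ultimately show "{\<sigma> s<..<\<tau> s} \<inter> {\<sigma> t<..<\<tau> t} = {}"
      unfolding disjnt_def by (simp only: image_Int[OF inj, symmetric] image_is_empty)
  qed
qed

section \<open>Primitive vectors, widths and heights\<close>

lemma primitive_iff:
  "primitive v \<longleftrightarrow> (\<exists>p q :: int. coprime p q \<and> v $ 1 = p \<and> v $ 2 = q)"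
  unfolding primitive_def by (simp add: vec2_eq_iff)

lemma primitive_lattice: "primitive v \<Longrightarrow> v \<in> lattice"
  by (auto simp: primitive_iff lattice_def forall_2)

lemma lattice_diff: "u \<in> lattice \<Longrightarrow> v \<in> lattice \<Longrightarrow> u - v \<in> lattice"
  and lattice_add: "u \<in> lattice \<Longrightarrow> v \<in> lattice \<Longrightarrow> u + v \<in> lattice"
  and lattice_scale: "c \<in> \<int> \<Longrightarrow> v \<in> lattice \<Longrightarrow> c *\<^sub>R v \<in> lattice"
  by (auto simp: lattice_def)

lemma primitive_scale_Ints:
  assumes "primitive t" "c *\<^sub>R t \<in> lattice"
  shows "c \<in> \<int>"
proof -
  obtain p q where pq: "coprime p q" "t $ 1 = of_int p" "t $ 2 = of_int q"
    using assms by (auto simp: primitive_iff)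
  then obtain x y where "x * p + y * q = 1" by (metis bezout_int coprime_iff_gcd_eq_1)
  then have "real_of_int x * p + y * q = 1" by (metis of_int_1 of_int_add of_int_mult)
  then have "c = of_int x * (c * t $ 1) + of_int y * (c * t $ 2)"
    using pq by (simp add: algebra_simps) (metis distrib_left mult.right_neutral)
  moreover have "c * t $ 1 \<in> \<int>" "c * t $ 2 \<in> \<int>" using assms(2) by (auto simp: lattice_def)
  ultimately show ?thesis by (metis Ints_add Ints_mult Ints_of_int)
qed

lemma primitive_parallel:
  assumes "primitive t" "primitive t'" "t' = c *\<^sub>R t" "0 < c"
  shows "t' = t"
proof -
  have "c \<in> \<int>" using assms primitive_scale_Ints primitive_lattice by metis
  moreover have "(1 / c) *\<^sub>R t' \<in> lattice" using assms primitive_lattice by simp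
  then have "1 / c \<in> \<int>" using assms(2) primitive_scale_Ints by blast
  ultimately have "1 \<le> c" "1 \<le> 1 / c"
    using assms(4) Ints_nonzero_abs_ge1[of c] Ints_nonzero_abs_ge1[of "1 / c"] by auto
  then have "c = 1" using assms(4) by (simp add: field_simps)
  then show ?thesis using assms by simp
qed

lemma lattice_segment_direction:
  assumes "u \<in> lattice" "w \<in> lattice" "u \<noteq> w"
  obtains t m where "primitive t" "0 < m" "w = u + real m *\<^sub>R t"
proof -
  obtain p q where pq: "(w - u) $ 1 = of_int p" "(w - u) $ 2 = of_int q"
    using lattice_diff[OF assms(2,1)] unfolding lattice_def mem_Collect_eq by (meson Ints_cases)
  have nz: "p \<noteq> 0 \<or> q \<noteq> 0" using pq assms(3) by (auto simp: vec2_eq_iff)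
  define g where "g = gcd p q"
  have g: "0 < g" using nz by (simp add: g_def)
  obtain p' q' where "p = p' * g" "q = q' * g" "coprime p' q'"
    using gcd_coprime_exists[of p q] nz unfolding g_def by auto
  moreover have "real (nat g) = of_int g" using g by simp
  ultimately show ?thesis
    using that[of "vector [of_int p', of_int q']" "nat g"] g pq
    by (auto simp: primitive_def vec2_eq_iff algebra_simps)
qed

lemma lattice_width_segment:
  assumes "u \<in> lattice" "primitive t"
  shows "lattice_width (closed_segment u (u + real m *\<^sub>R t)) = m"
proof -
  let ?f = "\<lambda>i::nat. u + real i *\<^sub>R t"
  have t0: "t \<noteq> 0" using assms(2) by (auto simp: primitive_iff)
  have "closed_segment u (u + real m *\<^sub>R t) \<inter> lattice = ?f ` {0..m}"
  proof (intro set_eqI iffI)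
    fix x assume x: "x \<in> closed_segment u (u + real m *\<^sub>R t) \<inter> lattice"
    then obtain s :: real where s: "0 \<le> s" "s \<le> 1" "x = u + (s * m) *\<^sub>R t"
      by (auto simp: in_segment algebra_simps)
    have "(s * m) *\<^sub>R t \<in> lattice" using lattice_diff[of x u] x s assms by simp
    then have "s * m \<in> \<int>" using primitive_scale_Ints assms by blast
    then obtain k where k: "s * m = of_int k" by (auto elim: Ints_cases)
    have "0 \<le> s * m" "s * m \<le> m" using s by (auto intro: mult_left_le_one_le)
    then have "0 \<le> k" "k \<le> int m" using k by auto
    then have "x = ?f (nat k)" "nat k \<le> m" using s k by auto
    then show "x \<in> ?f ` {0..m}" by auto
  next
    fix x assume "x \<in> ?f ` {0..m}"
    then obtain i where i: "i \<le> m" "x = ?f i" by auto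
    have "x \<in> lattice" using i assms primitive_lattice by (auto intro!: lattice_add lattice_scale)
    moreover have "x \<in> closed_segment u (u + real m *\<^sub>R t)"
    proof (cases "m = 0")
      case False
      then show ?thesis unfolding in_segment using i
        by (intro exI[of _ "real i / real m"]) (auto simp: algebra_simps)
    qed (use i in simp)
    ultimately show "x \<in> closed_segment u (u + real m *\<^sub>R t) \<inter> lattice" by simp
  qed
  moreover have "inj_on ?f {0..m}" using t0 by (auto simp: inj_on_def)
  ultimately show ?thesis by (simp add: lattice_width_def card_image)
qed

lemma det2_int:
  assumes "u \<in> lattice" "v \<in> lattice" shows "det2 u v \<in> \<int>"
  using assms by (auto simp: det2_def lattice_def)

text \<open>
  The condition that \<open>P\<close> lies on the side \<open>w \<bullet> x \<ge> c\<close> excludes the normal \<open>- w\<close>, because the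
  origin belongs to \<open>P\<close> and \<open>c\<close> is negative.
\<close>

lemma inner_normal_eq:
  assumes "a \<noteq> b" "a \<in> E" "b \<in> E" "0 \<in> P" "primitive w" "\<And>x. x \<in> E \<Longrightarrow> w \<bullet> x = c"
    "\<And>x. x \<in> P \<Longrightarrow> c \<le> w \<bullet> x" "c < 0"
  shows "inner_normal P E = w"
  unfolding inner_normal_def
proof (rule the_equality)
  show "primitive w \<and> (\<exists>c. (\<forall>x\<in>E. w \<bullet> x = c) \<and> (\<forall>x\<in>P. w \<bullet> x \<ge> c))" using assms by blast
  fix w' assume "primitive w' \<and> (\<exists>c. (\<forall>x\<in>E. w' \<bullet> x = c) \<and> (\<forall>x\<in>P. w' \<bullet> x \<ge> c))"
  then obtain c' where w': "primitive w'" "\<And>x. x \<in> E \<Longrightarrow> w' \<bullet> x = c'" "\<And>x. x \<in> P \<Longrightarrow> c' \<le> w' \<bullet> x"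
    by blast
  have wa: "w \<bullet> (a - b) = 0" "w' \<bullet> (a - b) = 0" using assms w' by (simp_all add: inner_diff_right)
  have w0: "w \<bullet> a = c" using assms by blast
  define k where "k = c' / c"
  have "w' \<bullet> a = c'" using w' assms by blast
  then have z: "(w' - k *\<^sub>R w) \<bullet> a = 0" "(w' - k *\<^sub>R w) \<bullet> (a - b) = 0"
    using wa w0 assms(8) by (auto simp: inner_diff_left k_def)
  have "det2 a b \<noteq> 0"
  proof (rule det2_nonzero_if_level[of "(1 / c) *\<^sub>R w"])
    show "((1 / c) *\<^sub>R w) \<bullet> a = 1" "((1 / c) *\<^sub>R w) \<bullet> b = 1" using assms by auto
  qed (rule assms)
  define y :: "real^2" where "y = vector [- (w' - k *\<^sub>R w) $ 2, (w' - k *\<^sub>R w) $ 1]"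
  have "det2 a y = (w' - k *\<^sub>R w) \<bullet> a" "det2 b y = (w' - k *\<^sub>R w) \<bullet> a - (w' - k *\<^sub>R w) \<bullet> (a - b)"
    by (simp_all add: y_def det2_def inner_2 algebra_simps)
  then have "y = 0" using z \<open>det2 a b \<noteq> 0\<close> det2_eq_0_if[of a b y] by simp
  then have "w' = k *\<^sub>R w" by (simp add: y_def vec2_eq_iff)
  moreover have "c' \<le> 0" using w'(3)[OF assms(4)] by simp
  moreover have "c' \<noteq> 0"
  proof
    assume "c' = 0"
    then have "w' = 0" using \<open>w' = k *\<^sub>R w\<close> by (simp add: k_def)
    then show False using w'(1) by (auto simp: primitive_iff)
  qed
  ultimately have "w' = k *\<^sub>R w" "0 < k" using assms(8) by (auto simp: k_def divide_neg_neg)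
  then show "w' = w" by (rule primitive_parallel[OF assms(5) w'(1)])
qed

lemma edge_height_eq:
  assumes "x \<in> E" "\<And>x. x \<in> E \<Longrightarrow> inner_normal P E \<bullet> x = - real r"
  shows "edge_height P E = r"
  unfolding edge_height_def
  by (rule the_equality) (use assms in auto)

section \<open>Lattice points in cones\<close>

lemma finite_lattice_points:
  assumes "bounded A" shows "finite (A \<inter> lattice)"
proof -
  obtain B where B: "\<And>x. x \<in> A \<Longrightarrow> norm x \<le> B" using assms by (auto simp: bounded_iff)
  let ?I = "{x \<in> \<int>. \<bar>x\<bar> \<le> B}"
  have "finite ?I" by (rule finite_abs_int_segment)
  moreover have "A \<inter> lattice \<subseteq> (\<lambda>(x, y). vector [x, y]) ` (?I \<times> ?I)"
  proof
    fix v assume v: "v \<in> A \<inter> lattice"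
    have "\<bar>v $ i\<bar> \<le> B" for i
      using B[of v] component_le_norm_cart[of v i] v by simp
    then have "(v $ 1, v $ 2) \<in> ?I \<times> ?I" using v by (simp add: lattice_def)
    moreover have "v = (\<lambda>(x, y). vector [x, y]) (v $ 1, v $ 2)" by (simp add: vec2_eq_iff)
    ultimately show "v \<in> (\<lambda>(x, y). vector [x, y]) ` (?I \<times> ?I)" by (rule rev_image_eqI)
  qed
  ultimately show ?thesis by (meson finite_SigmaI finite_imageI finite_subset)
qed

text \<open>
  With \<open>w\<close> adjacent to \<open>a\<close>, the multiples \<open>j w\<close> for \<open>0 < j < d\<close> represent the nonzero classes of the
  lattice modulo \<open>a\<close> and \<open>b\<close>. Their representatives \<open>z j\<close> in the open parallelogram satisfy
  \<open>z (d - j) = a + b - z j\<close>, so at least one of each such pair lies in the triangle.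
\<close>

lemma many_lattice_points_in_triangle:
  assumes "primitive a" "primitive b" "0 < det2 a b"
  obtains Z where "finite Z" "Z \<subseteq> lattice" "det2 a b \<le> 2 * real (card Z) + 1"
    "\<And>z. z \<in> Z \<Longrightarrow> \<exists>\<alpha>>0. \<exists>\<beta>>0. \<alpha> + \<beta> \<le> 1 \<and> z = \<alpha> *\<^sub>R a + \<beta> *\<^sub>R b"
proof -
  obtain p q where a: "coprime p q" "a $ 1 = of_int p" "a $ 2 = of_int q"
    using assms(1) by (auto simp: primitive_iff)
  obtain p' q' where b: "coprime p' q'" "b $ 1 = of_int p'" "b $ 2 = of_int q'"
    using assms(2) by (auto simp: primitive_iff)
  obtain x y where xy: "x * p + y * q = 1" using a(1) by (metis bezout_int coprime_iff_gcd_eq_1)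
  define d where "d = p * q' - q * p'"
  \<comment> \<open>The vector \<open>w = (- y, x)\<close> has determinant 1 with \<open>a\<close>, and \<open>d w = b + e a\<close>.\<close>
  define e where "e = - y * q' - x * p'"
  have det: "det2 a b = of_int d" using a b by (simp add: det2_def d_def)
  have d: "0 < d" using assms(3) det by simp
  have dw: "d * (- y) = p' + e * p" "d * x = q' + e * q"
    using xy unfolding d_def e_def by algebra+
  have "coprime d e"
  proof (rule coprimeI)
    fix c assume "c dvd d" "c dvd e"
    then have "c dvd p'" "c dvd q'" using dw by (metis dvd_add_left_iff dvd_mult2)+
    then show "is_unit c" using b(1) by (metis coprime_common_divisor)
  qed
  define w :: "real^2" where "w = vector [of_int (- y), of_int x]"
  define z where "z j = of_int j *\<^sub>R w - of_int (j * e div d) *\<^sub>R a" for j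
  have "real_of_int d * of_int (- y) = of_int p' + e * p" "real_of_int d * x = of_int q' + e * q"
    using arg_cong[OF dw(1), of real_of_int] arg_cong[OF dw(2), of real_of_int] by simp_all
  then have w: "of_int d *\<^sub>R w = b + of_int e *\<^sub>R a"
    using a b by (simp add: vec2_eq_iff w_def)
  have z: "z j = (of_int (j * e mod d) / of_int d) *\<^sub>R a + (of_int j / of_int d) *\<^sub>R b" for j
  proof -
    have "w = (1 / of_int d) *\<^sub>R (b + of_int e *\<^sub>R a)" using w d by (simp flip: w)
    then have "z j = (of_int (j * e) / of_int d - of_int (j * e div d)) *\<^sub>R a + (of_int j / of_int d) *\<^sub>R b"
      by (simp add: z_def algebra_simps)
    moreover have "real_of_int (j * e) / of_int d - of_int (j * e div d) = of_int (j * e mod d) / of_int d"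
      using d by (simp add: field_simps flip: of_int_mult of_int_add)
    ultimately show ?thesis by simp
  qed
  have mod_pos: "0 < j * e mod d" if "j \<in> {1..d - 1}" for j
  proof -
    have "\<not> d dvd j * e"
    proof
      assume "d dvd j * e"
      then have "d dvd j" using \<open>coprime d e\<close> coprime_dvd_mult_left_iff by blast
      then show False using that zdvd_not_zless by auto
    qed
    then show ?thesis using d by (simp add: dvd_eq_mod_eq_0 order_less_le)
  qed
  define G where "G = {j \<in> {1..d - 1}. j * e mod d + j \<le> d}"
  have fin: "finite G" unfolding G_def by (rule finite_subset[of _ "{1..d - 1}"]) auto
  have "{1..d - 1} \<subseteq> G \<union> (\<lambda>j. d - j) ` G"
  proof
    fix j assume j: "j \<in> {1..d - 1}"
    show "j \<in> G \<union> (\<lambda>j. d - j) ` G"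
    proof (cases "j * e mod d + j \<le> d")
      case True
      then show ?thesis using j by (simp add: G_def)
    next
      case False
      have "(d - j) * e mod d = (- (j * e)) mod d"
        by (simp add: left_diff_distrib mod_diff_left_eq[symmetric, of "d * e"])
      also have "\<dots> = d - j * e mod d"
        using mod_pos[OF j] by (simp add: zmod_zminus1_eq_if)
      finally have "d - j \<in> G" using False j by (simp add: G_def)
      then show ?thesis by (intro UnI2 image_eqI[where x="d - j"]) auto
    qed
  qed
  then have "card {1..d - 1} \<le> card (G \<union> (\<lambda>j. d - j) ` G)" using fin by (intro card_mono) auto
  also have "\<dots> \<le> card G + card G"
    using card_Un_le[of G "(\<lambda>j. d - j) ` G"] card_image_le[OF fin, of "\<lambda>j. d - j"] by linarith
  finally have "nat (d - 1) \<le> 2 * card G" by simp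
  moreover have "inj z"
  proof (rule injI)
    fix i j assume "z i = z j"
    moreover have "det2 a (z i) = of_int i / of_int d * det2 a b" for i by (simp add: z)
    ultimately show "i = j" using d det by (metis nonzero_divide_eq_eq of_int_0_eq_iff of_int_eq_iff order_less_irrefl)
  qed
  then have "card (z ` G) = card G" by (meson card_image inj_on_subset subset_UNIV)
  ultimately have "det2 a b \<le> 2 * real (card (z ` G)) + 1" using d unfolding det by linarith
  moreover have "z ` G \<subseteq> lattice"
  proof -
    have "w \<in> lattice" by (simp add: w_def lattice_def forall_2)
    then show ?thesis unfolding z_def using assms(1) primitive_lattice
      by (auto intro!: lattice_diff lattice_scale)
  qed
  moreover have "\<exists>\<alpha>>0. \<exists>\<beta>>0. \<alpha> + \<beta> \<le> 1 \<and> v = \<alpha> *\<^sub>R a + \<beta> *\<^sub>R b" if v: "v \<in> z ` G" for v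
  proof -
    obtain j where j: "j \<in> G" "v = z j" using v by auto
    let ?\<alpha> = "real_of_int (j * e mod d) / of_int d" and ?\<beta> = "real_of_int j / of_int d"
    have "0 < ?\<alpha>" "0 < ?\<beta>" using j mod_pos[of j] d by (auto simp: G_def)
    moreover have "?\<alpha> + ?\<beta> \<le> 1"
    proof -
      have "real_of_int (j * e mod d + j) \<le> of_int d" using j unfolding G_def by (metis (mono_tags, lifting) mem_Collect_eq of_int_le_iff)
      then show ?thesis using d by (simp add: add_divide_distrib[symmetric])
    qed
    ultimately show ?thesis using z[of j] j by blast
  qed
  ultimately show ?thesis using that[of "z ` G"] fin by blast
qed

lemma positive_combination_in_cone:
  assumes "0 < det2 a b" "0 < \<alpha>" "0 < \<beta>"
  shows "\<alpha> *\<^sub>R a + \<beta> *\<^sub>R b \<in> interior (conic hull closed_segment a b)"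
proof (rule interiorI)
  let ?U = "{z. 0 < det2 a z \<and> 0 < det2 z b}"
  show "open ?U" unfolding det2_def
    by (intro open_Collect_conj open_Collect_less continuous_intros)
  show "\<alpha> *\<^sub>R a + \<beta> *\<^sub>R b \<in> ?U" using assms by simp
  show "?U \<subseteq> conic hull closed_segment a b"
  proof
    fix z assume z: "z \<in> ?U"
    define x where "x = det2 z b / det2 a b"
    define y where "y = det2 a z / det2 a b"
    have xy: "0 < x" "0 < y" using z assms by (simp_all add: x_def y_def)
    have "z - (x *\<^sub>R a + y *\<^sub>R b) = 0"
      by (rule det2_eq_0_if[of a b])
        (use assms in \<open>simp_all add: x_def y_def det2_swap[of b z] det2_swap[of b a]\<close>)
    then have "z = (x + y) *\<^sub>R ((1 - y / (x + y)) *\<^sub>R a + (y / (x + y)) *\<^sub>R b)"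
      unfolding scaleR_add_right scaleR_scaleR using xy by (simp add: right_diff_distrib)
    moreover have "(1 - y / (x + y)) *\<^sub>R a + (y / (x + y)) *\<^sub>R b \<in> closed_segment a b"
      unfolding in_segment using xy by (intro exI[of _ "y / (x + y)"]) auto
    ultimately show "z \<in> conic hull closed_segment a b"
      unfolding conic_hull_explicit using xy by (metis (mono_tags, lifting) add_pos_pos less_imp_le mem_Collect_eq)
  qed
qed

section \<open>Defects of cones in the plane\<close>

text \<open>
  The first coordinate after the shear \<open>(x, y) \<mapsto> (x + N y, y)\<close>. For a given nonzero lattice vector
  it vanishes for at most one \<open>N\<close>, so that some \<open>N\<close> is suitable for finitely many given vectors.
\<close>

definition sheared :: "int \<Rightarrow> real^2 \<Rightarrow> real" where
  "sheared N z = z $ 1 + of_int N * z $ 2"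

definition defect :: "int \<Rightarrow> real^2 \<Rightarrow> real^2 \<Rightarrow> real" where
  "defect N u w = cone_defect (\<lfloor>u $ 1\<rfloor> + N * \<lfloor>u $ 2\<rfloor>) \<lfloor>u $ 2\<rfloor> (\<lfloor>w $ 1\<rfloor> + N * \<lfloor>w $ 2\<rfloor>) \<lfloor>w $ 2\<rfloor>"

definition rademacher_at :: "int \<Rightarrow> real^2 \<Rightarrow> real" where
  "rademacher_at N z = even_rademacher (\<lfloor>z $ 1\<rfloor> + N * \<lfloor>z $ 2\<rfloor>) \<lfloor>z $ 2\<rfloor>"

lemma defect_eq:
  assumes "u \<in> lattice" "w \<in> lattice"
  shows "defect N u w =
    (2 - sheared N u / sheared N w - sheared N w / sheared N u) / det2 u w
    + rademacher_at N w - rademacher_at N u - (if sheared N u * sheared N w < 0 then 6 else 0)"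
proof -
  have fl: "of_int \<lfloor>z $ i\<rfloor> = z $ i" if "z \<in> lattice" for z :: "real^2" and i
    using that by (simp add: lattice_def)
  let ?X = "\<lambda>z. \<lfloor>z $ 1\<rfloor> + N * \<lfloor>z $ 2\<rfloor>"
  have X: "real_of_int (?X z) = sheared N z" if "z \<in> lattice" for z
    unfolding sheared_def of_int_add of_int_mult fl[OF that] by simp
  have det: "sheared N u * of_int \<lfloor>w $ 2\<rfloor> - of_int \<lfloor>u $ 2\<rfloor> * sheared N w = det2 u w"
    unfolding fl[OF assms(1)] fl[OF assms(2)] by (simp add: sheared_def det2_def algebra_simps)
  have neg: "?X u * ?X w < 0 \<longleftrightarrow> sheared N u * sheared N w < 0"
    unfolding X[OF assms(1), symmetric] X[OF assms(2), symmetric] by (simp only: of_int_less_0_iff flip: of_int_mult)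
  show ?thesis
    unfolding defect_def cone_defect_def rademacher_at_def neg X[OF assms(1)] X[OF assms(2)] det ..
qed

lemma finite_sheared_zero:
  assumes "z \<noteq> 0"
  shows "finite {N. sheared N z = 0}"
proof (cases "z $ 2 = 0")
  case True
  then show ?thesis using assms by (simp add: sheared_def vec2_eq_iff)
next
  case False
  have "{N. sheared N z = 0} \<subseteq> {\<lfloor>- z $ 1 / z $ 2\<rfloor>}"
  proof
    fix N assume "N \<in> {N. sheared N z = 0}"
    then have "of_int N = - z $ 1 / z $ 2" using False by (simp add: sheared_def field_simps)
    then show "N \<in> {\<lfloor>- z $ 1 / z $ 2\<rfloor>}" by (metis floor_of_int singletonI)
  qed
  then show ?thesis by (rule finite_subset) simp
qed

text \<open>
  The defect in the coordinates sheared by \<open>N\<close> is \<open>K\<close> for almost all \<open>N\<close>. The exceptions come from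
  vertical vectors, at which the defect has no meaning.
\<close>

definition cone_constant :: "real^2 \<Rightarrow> real^2 \<Rightarrow> real \<Rightarrow> bool" where
  "cone_constant u w K \<longleftrightarrow> finite {N. defect N u w \<noteq> K}"

lemma cone_constantI:
  assumes "cone_value \<lfloor>u $ 1\<rfloor> \<lfloor>u $ 2\<rfloor> \<lfloor>w $ 1\<rfloor> \<lfloor>w $ 2\<rfloor> K"
  shows "cone_constant u w K"
proof -
  obtain W :: "(int \<times> int) set" where W: "finite W" "(0, 0) \<notin> W" and
    KW: "\<And>a b c d. a * d - b * c = 1 \<Longrightarrow> (\<forall>(m, n) \<in> W. a * m + b * n \<noteq> 0) \<Longrightarrow>
          cone_defect (a * \<lfloor>u $ 1\<rfloor> + b * \<lfloor>u $ 2\<rfloor>) (c * \<lfloor>u $ 1\<rfloor> + d * \<lfloor>u $ 2\<rfloor>)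
            (a * \<lfloor>w $ 1\<rfloor> + b * \<lfloor>w $ 2\<rfloor>) (c * \<lfloor>w $ 1\<rfloor> + d * \<lfloor>w $ 2\<rfloor>) = K"
    using assms unfolding cone_value_def by (elim exE conjE) metis
  have "defect N u w = K" if "\<forall>(m, n) \<in> W. m + N * n \<noteq> 0" for N
    using KW[of 1 1 N 0] that by (simp add: defect_def case_prod_unfold)
  then have "{N. defect N u w \<noteq> K} \<subseteq> (\<Union>(m, n)\<in>W. {N. m + N * n = 0})"
    by blast
  moreover have "finite {N. m + N * n = 0}" if "(m, n) \<in> W" for m n :: int
  proof -
    have "(vector [of_int m, of_int n] :: real^2) \<noteq> 0"
      using that W(2) by (auto simp: vec2_eq_iff)
    from finite_sheared_zero[OF this] show ?thesis
      by (rule rev_finite_subset) (auto simp: sheared_def simp flip: of_int_mult of_int_add)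
  qed
  ultimately show ?thesis unfolding cone_constant_def using W(1) by (elim finite_subset) auto
qed

lemma floor_primitive:
  assumes "primitive u"
  obtains p q where "coprime p q" "u $ 1 = of_int p" "u $ 2 = of_int q" "\<lfloor>u $ 1\<rfloor> = p" "\<lfloor>u $ 2\<rfloor> = q"
  using assms by (auto simp: primitive_iff)

lemma finite_cone_constants:
  "\<exists>V. finite V \<and> (\<forall>u w. primitive u \<longrightarrow> primitive w \<longrightarrow> 0 < det2 u w \<longrightarrow>
      det2 u w \<le> real D \<longrightarrow> (\<exists>K\<in>V. cone_constant u w K))"
proof -
  obtain V where V: "finite V" "\<And>p q p' q'. coprime p q \<Longrightarrow> coprime p' q' \<Longrightarrow> 0 < p * q' - q * p' \<Longrightarrow>
      p * q' - q * p' \<le> int D \<Longrightarrow> (\<exists>K\<in>V. cone_value p q p' q' K)"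
    using finite_cone_values[of D] by blast
  have "\<exists>K\<in>V. cone_constant u w K"
    if uw: "primitive u" "primitive w" "0 < det2 u w" "det2 u w \<le> real D" for u w
  proof -
    obtain p q where u: "coprime p q" "u $ 1 = of_int p" "u $ 2 = of_int q" "\<lfloor>u $ 1\<rfloor> = p" "\<lfloor>u $ 2\<rfloor> = q"
      by (rule floor_primitive[OF uw(1)])
    obtain p' q' where w: "coprime p' q'" "w $ 1 = of_int p'" "w $ 2 = of_int q'" "\<lfloor>w $ 1\<rfloor> = p'" "\<lfloor>w $ 2\<rfloor> = q'"
      by (rule floor_primitive[OF uw(2)])
    have det: "det2 u w = of_int (p * q' - q * p')" using u w by (simp add: det2_def)
    have "0 < p * q' - q * p'" "p * q' - q * p' \<le> int D"
      using uw(3,4) unfolding det by linarith+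
    then obtain K where "K \<in> V" "cone_value p q p' q' K" using V(2) u(1) w(1) by blast
    then show ?thesis using cone_constantI[of u w K] u w by auto
  qed
  then show ?thesis using V(1) by blast
qed

lemma cone_constant_full_width:
  assumes "primitive u" "primitive t" "det2 u t = real r" "0 < r"
  shows "cone_constant u (u + real r *\<^sub>R t) (- 1)"
proof -
  obtain p q where u: "coprime p q" "u $ 1 = of_int p" "u $ 2 = of_int q" "\<lfloor>u $ 1\<rfloor> = p" "\<lfloor>u $ 2\<rfloor> = q"
    by (rule floor_primitive[OF assms(1)])
  obtain i j where t: "coprime i j" "t $ 1 = of_int i" "t $ 2 = of_int j"
    using assms(2) by (auto simp: primitive_iff)
  have "real_of_int (p * j - q * i) = of_int (int r)"
    using assms(3) u t by (simp add: det2_def)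
  then have "p * j - q * i = int r" by (simp only: of_int_eq_iff)
  then have "cone_value p q (p + int r * i) (q + int r * j) (- 1)"
    using u(1) t(1) assms(4) by (intro cone_value_full_width) auto
  moreover have "(u + real r *\<^sub>R t) $ 1 = of_int (p + int r * i)"
     "(u + real r *\<^sub>R t) $ 2 = of_int (q + int r * j)" using u t by simp_all
  ultimately show ?thesis using u(4,5)
    by (intro cone_constantI) (simp only: floor_of_int)
qed

text \<open>
  Along an edge the defect is a difference of values at the two endpoints: the linear form \<open>X\<close> is
  monotone on the edge, so that the correction term for crossing \<open>X = 0\<close> is, up to the sign of
  \<open>\<delta>\<close>, a difference of indicators of \<open>X > 0\<close>; and the contribution to the dual area is
  \<open>\<delta> / det (a, b)\<close> times the difference of the values of \<open>1 / X\<close>.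
\<close>

lemma defect_difference:
  fixes a b :: "real^2" and N :: int
  defines "\<gamma> \<equiv> \<lambda>t. a + t *\<^sub>R (b - a)"
  defines "\<delta> \<equiv> sheared N b - sheared N a"
  defines "f \<equiv> \<lambda>t. \<delta> / det2 a b / sheared N (\<gamma> t) + rademacher_at N (\<gamma> t)
                   - 6 * sgn \<delta> * (if 0 < sheared N (\<gamma> t) then 1 else 0)"
  assumes "\<sigma> < \<tau>" "\<gamma> \<sigma> \<in> lattice" "\<gamma> \<tau> \<in> lattice" "sheared N (\<gamma> \<sigma>) \<noteq> 0" "sheared N (\<gamma> \<tau>) \<noteq> 0"
    and "0 < det2 a b"
  shows "defect N (\<gamma> \<sigma>) (\<gamma> \<tau>) = f \<tau> - f \<sigma>"
proof -
  let ?X = "\<lambda>t. sheared N (\<gamma> t)"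
  have X: "?X t = sheared N a + t * \<delta>" for t
    by (simp add: sheared_def \<gamma>_def \<delta>_def algebra_simps)
  have diff: "?X \<tau> - ?X \<sigma> = (\<tau> - \<sigma>) * \<delta>" by (simp add: X algebra_simps)
  have det: "det2 (\<gamma> \<sigma>) (\<gamma> \<tau>) = (\<tau> - \<sigma>) * det2 a b"
    by (simp add: \<gamma>_def det2_swap[of b a] algebra_simps)
  have "2 - ?X \<sigma> / ?X \<tau> - ?X \<tau> / ?X \<sigma> = (?X \<tau> - ?X \<sigma>) * (1 / ?X \<tau> - 1 / ?X \<sigma>)"
    using assms(7,8) by (simp add: field_simps)
  then have 1: "(2 - ?X \<sigma> / ?X \<tau> - ?X \<tau> / ?X \<sigma>) / det2 (\<gamma> \<sigma>) (\<gamma> \<tau>)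
      = \<delta> / det2 a b / ?X \<tau> - \<delta> / det2 a b / ?X \<sigma>"
  proof -
    assume *: "2 - ?X \<sigma> / ?X \<tau> - ?X \<tau> / ?X \<sigma> = (?X \<tau> - ?X \<sigma>) * (1 / ?X \<tau> - 1 / ?X \<sigma>)"
    have "(\<tau> - \<sigma>) * \<delta> * (1 / ?X \<tau> - 1 / ?X \<sigma>) / ((\<tau> - \<sigma>) * det2 a b)
        = \<delta> / det2 a b * (1 / ?X \<tau> - 1 / ?X \<sigma>)"
      using assms(4) by simp
    then show ?thesis unfolding * det diff by (simp add: right_diff_distrib)
  qed
  have 2: "(if ?X \<sigma> * ?X \<tau> < 0 then 6 else 0) =
      6 * sgn \<delta> * (if 0 < ?X \<tau> then 1 else 0) - 6 * sgn \<delta> * (if 0 < ?X \<sigma> then 1 else 0)"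
  proof -
    consider "0 < \<delta>" | "\<delta> = 0" | "\<delta> < 0" by linarith
    then show ?thesis
    proof cases
      case 1
      then have "?X \<sigma> < ?X \<tau>" using diff assms(4) by (metis diff_gt_0_iff_gt mult_pos_pos)
      then show ?thesis using 1 assms(7,8) by (auto simp: mult_less_0_iff)
    next
      case 2
      then have "?X \<sigma> = ?X \<tau>" using diff by simp
      then show ?thesis using 2 by (simp add: not_less)
    next
      case 3
      then have "(\<tau> - \<sigma>) * \<delta> < 0" using assms(4) by (simp add: mult_pos_neg)
      then have "?X \<tau> < ?X \<sigma>" using diff by linarith
      then show ?thesis using 3 assms(7,8) by (auto simp: mult_less_0_iff)
    qed
  qed
  show ?thesis unfolding defect_eq[OF assms(5,6)] 1 2 by (simp add: f_def)
qed

section \<open>Fano polygons and their decompositions\<close>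

locale fano = polygon_around_origin +
  assumes primitive_vertices: "v \<in> vertices \<Longrightarrow> primitive v"
begin

lemma primitive_ends: "E \<in> edges \<Longrightarrow> primitive (src E)" "E \<in> edges \<Longrightarrow> primitive (tgt E)"
  using ends_in_edge primitive_vertices by (auto simp: vertices_def)

text \<open>
  The height of an edge is the determinant of its starting point and its primitive direction.
\<close>

lemma edge_direction:
  assumes E: "E \<in> edges"
  obtains t k where "primitive t" "0 < k" "tgt E = src E + real k *\<^sub>R t"
    "det2 (src E) t = real (edge_height P E)" "0 < edge_height P E"
proof -
  let ?a = "src E" and ?b = "tgt E"
  have lat: "?a \<in> lattice" "?b \<in> lattice" using primitive_ends[OF E] primitive_lattice by auto
  have det: "0 < det2 ?a ?b" using edge_ends[OF E] by simp
  then have ne: "?a \<noteq> ?b" by auto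
  obtain t k where t: "primitive t" "0 < k" "?b = ?a + real k *\<^sub>R t"
    using lattice_segment_direction[OF lat ne] by metis
  have det': "det2 ?a ?b = k * det2 ?a t" by (subst t(3)) simp
  have pos: "0 < det2 ?a t" using det t(2) unfolding det' by (simp add: zero_less_mult_iff)
  have "det2 ?a t \<in> \<int>" using det2_int lat primitive_lattice t(1) by blast
  then obtain i where i: "det2 ?a t = of_int i" by (auto elim: Ints_cases)
  define r where "r = nat i"
  have r: "det2 ?a t = real r" "0 < r" using i pos by (simp_all add: r_def)
  define w :: "real^2" where "w = vector [- t $ 2, t $ 1]"
  have w: "w \<bullet> z = - real r * (functional E \<bullet> z)" for z
  proof -
    have "functional E \<bullet> z = det2 z (?b - ?a) / det2 ?a ?b"
      by (simp add: functional_def edge_functional_inner)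
    also have "?b - ?a = real k *\<^sub>R t" by (subst t(3)) simp
    also have "det2 z (real k *\<^sub>R t) / det2 ?a ?b = det2 z t / real r"
      using t(2) det' r by simp
    finally show ?thesis using r(2) by (simp add: w_def inner_2 det2_def)
  qed
  have "inner_normal P E = w"
  proof (rule inner_normal_eq[OF ne ends_in_edge(1,2)[OF E]])
    show "0 \<in> P" using origin interior_subset by blast
    obtain i j where "coprime i j" "t $ 1 = of_int i" "t $ 2 = of_int j"
      using t(1) by (auto simp: primitive_iff)
    then show "primitive w" unfolding primitive_iff w_def
      by (intro exI[of _ "- j"] exI[of _ i]) (simp add: coprime_commute)
    show "w \<bullet> x = - real r" if "x \<in> E" for x
      using functional_on_edge[OF E that] by (simp add: w)
    show "- real r \<le> w \<bullet> x" if "x \<in> P" for x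
      using functional(2)[OF E that] r(2) by (simp add: w mult_left_le)
    show "- real r < 0" using r by simp
  qed
  then have "edge_height P E = r"
    using ends_in_edge(1)[OF E] functional_on_edge[OF E] by (intro edge_height_eq[of ?a]) (auto simp: w)
  then show ?thesis using that[OF t] r by simp
qed

text \<open>
  The primitive direction of a lattice segment in an edge is that of the edge, so its width is
  the factor by which this direction is multiplied.
\<close>

lemma segment_in_edge:
  assumes E: "E \<in> edges"
    and t: "primitive t" "0 < k" "tgt E = src E + real k *\<^sub>R t"
    and s: "s = closed_segment u w" "primitive u" "primitive w" "s \<subseteq> E" "0 < lattice_width s"
  shows "primitive (src s)" "primitive (tgt s)" "s = closed_segment (src s) (tgt s)"
    "tgt s = src s + real (lattice_width s) *\<^sub>R t" "det2 (src s) t = det2 (src E) t"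
    "\<exists>\<sigma> \<tau>. \<sigma> < \<tau> \<and> src s = src E + \<sigma> *\<^sub>R (tgt E - src E) \<and> tgt s = src E + \<tau> *\<^sub>R (tgt E - src E)"
proof -
  let ?a = "src E" and ?b = "tgt E"
  have ab: "?b - ?a = real k *\<^sub>R t" by (subst t(3)) simp
  have uwE: "u \<in> E" "w \<in> E" using s by auto
  have on_line: "\<exists>\<sigma>. x = ?a + \<sigma> *\<^sub>R (?b - ?a)" if "x \<in> E" for x
  proof -
    have "x \<in> closed_segment ?a ?b" using edge_ends(1)[OF E] that by metis
    then obtain \<sigma> where "x = (1 - \<sigma>) *\<^sub>R ?a + \<sigma> *\<^sub>R ?b" by (auto simp: in_segment)
    then have "x = ?a + \<sigma> *\<^sub>R (?b - ?a)" by (simp add: algebra_simps)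
    then show ?thesis by blast
  qed
  obtain \<sigma> \<tau> where \<sigma>\<tau>: "u = ?a + \<sigma> *\<^sub>R (?b - ?a)" "w = ?a + \<tau> *\<^sub>R (?b - ?a)"
    using on_line uwE by metis
  have "u \<noteq> w"
  proof
    assume "u = w"
    then have "s \<inter> lattice \<subseteq> {u}" using s(1) by auto
    then have "card (s \<inter> lattice) \<le> 1" using card_mono[of "{u}"] by simp
    then show False using s(5) by (simp add: lattice_width_def)
  qed
  then have "\<sigma> \<noteq> \<tau>" using \<sigma>\<tau> by auto
  then have "\<exists>u w \<sigma> \<tau>. s = closed_segment u w \<and> primitive u \<and> primitive w \<and> \<sigma> < \<tau> \<and>
      u = ?a + \<sigma> *\<^sub>R (?b - ?a) \<and> w = ?a + \<tau> *\<^sub>R (?b - ?a)"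
    using s \<sigma>\<tau> closed_segment_commute[of u w] by (metis linorder_neqE_linordered_idom)
  then obtain u w \<sigma> \<tau> where s': "s = closed_segment u w" "primitive u" "primitive w" "\<sigma> < \<tau>"
    and u: "u = ?a + \<sigma> *\<^sub>R (?b - ?a)" and w: "w = ?a + \<tau> *\<^sub>R (?b - ?a)" by blast
  have "det2 u w = (\<tau> - \<sigma>) * det2 ?a ?b"
    by (simp add: u w det2_swap[of ?b ?a] algebra_simps)
  then have pos: "0 < det2 u w" using s'(4) edge_ends(2)[OF E] by simp
  have src: "src s = u" "tgt s = w" using src_tgt[OF s'(1) pos] by auto
  have "u \<noteq> w" using pos by auto
  then obtain t' m where t': "primitive t'" "0 < m" "w = u + real m *\<^sub>R t'"
    using lattice_segment_direction s' primitive_lattice by metis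
  have "real m *\<^sub>R t' = w - u" using t'(3) by simp
  also have "\<dots> = ((\<tau> - \<sigma>) * k) *\<^sub>R t"
    unfolding u w ab by (simp add: algebra_simps)
  finally have "t' = ((\<tau> - \<sigma>) * k / m) *\<^sub>R t"
    using t'(2) by (metis (no_types, lifting) divide_inverse_commute of_nat_0_less_iff order_less_irrefl
      real_vector_affinity_eq scaleR_scaleR vector_fraction_eq_iff)
  moreover have "0 < (\<tau> - \<sigma>) * k / m" using s'(4) t(2) t'(2) by simp
  ultimately have tt: "t' = t" using primitive_parallel[OF t(1) t'(1)] by blast
  have "lattice_width s = m"
    unfolding s'(1) t'(3) by (rule lattice_width_segment) (use s' t' primitive_lattice in auto)
  then show "tgt s = src s + real (lattice_width s) *\<^sub>R t" using t'(3) tt src by simp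
  show "primitive (src s)" "primitive (tgt s)" "s = closed_segment (src s) (tgt s)"
    using s' src by auto
  show "det2 (src s) t = det2 (src E) t" unfolding src u ab by simp
  show "\<exists>\<sigma> \<tau>. \<sigma> < \<tau> \<and> src s = ?a + \<sigma> *\<^sub>R (?b - ?a) \<and> tgt s = ?a + \<tau> *\<^sub>R (?b - ?a)"
    using s'(4) u w src by blast
qed

lemma decomposition_segment:
  assumes E: "E \<in> edges" and dec: "edge_decomposition P E T R" and s: "s \<in> T \<union> R"
  shows "primitive (src s)" "primitive (tgt s)" "s = closed_segment (src s) (tgt s)"
    "\<exists>t. primitive t \<and> tgt s = src s + real (lattice_width s) *\<^sub>R t \<and>
      det2 (src s) t = real (edge_height P E)"
    "0 < det2 (src s) (tgt s)"
    "\<exists>\<sigma> \<tau>. \<sigma> < \<tau> \<and> src s = src E + \<sigma> *\<^sub>R (tgt E - src E) \<and> tgt s = src E + \<tau> *\<^sub>R (tgt E - src E)"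
    "0 < edge_height P E" "s \<in> T \<Longrightarrow> lattice_width s = edge_height P E"
    "s \<in> R \<Longrightarrow> 0 < lattice_width s \<and> lattice_width s < edge_height P E"
proof -
  obtain t k where t: "primitive t" "0 < k" "tgt E = src E + real k *\<^sub>R t"
    and r: "det2 (src E) t = real (edge_height P E)" "0 < edge_height P E"
    by (rule edge_direction[OF E])
  show "0 < edge_height P E" by fact
  show T: "s \<in> T \<Longrightarrow> lattice_width s = edge_height P E"
    using dec by (auto simp: edge_decomposition_def Let_def)
  show R: "s \<in> R \<Longrightarrow> 0 < lattice_width s \<and> lattice_width s < edge_height P E"
    using dec r(2) by (auto simp: edge_decomposition_def Let_def split: if_splits)
  have pos: "0 < lattice_width s" using s T R r by auto
  obtain u w where uw: "primitive u" "primitive w" "s = closed_segment u w" and sub: "s \<subseteq> E"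
  proof -
    have "\<exists>a b. primitive a \<and> primitive b \<and> s = closed_segment a b" "\<Union> (T \<union> R) = E"
      using dec s unfolding edge_decomposition_def Let_def by blast+
    then show ?thesis using that s by blast
  qed
  note seg = segment_in_edge[OF E t uw(3,1,2) sub pos]
  show "primitive (src s)" "primitive (tgt s)" "s = closed_segment (src s) (tgt s)"
    by (fact seg)+
  show "\<exists>t. primitive t \<and> tgt s = src s + real (lattice_width s) *\<^sub>R t \<and>
      det2 (src s) t = real (edge_height P E)" using t seg r by auto
  have "det2 (src s) (tgt s) = real (lattice_width s) * real (edge_height P E)"
    by (subst seg(4)) (simp add: seg(5) r)
  then show "0 < det2 (src s) (tgt s)" using pos r by simp
  show "\<exists>\<sigma> \<tau>. \<sigma> < \<tau> \<and> src s = src E + \<sigma> *\<^sub>R (tgt E - src E) \<and> tgt s = src E + \<tau> *\<^sub>R (tgt E - src E)"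
    by (fact seg)
qed

lemma edge_defect_sum:
  assumes E: "E \<in> edges" and dec: "edge_decomposition P E T R"
    and nz: "\<And>s. s \<in> T \<union> R \<Longrightarrow> sheared N (src s) \<noteq> 0 \<and> sheared N (tgt s) \<noteq> 0"
      "sheared N (src E) \<noteq> 0" "sheared N (tgt E) \<noteq> 0"
  shows "(\<Sum>s\<in>T \<union> R. defect N (src s) (tgt s)) = defect N (src E) (tgt E)"
proof -
  let ?a = "src E" and ?b = "tgt E"
  let ?\<gamma> = "\<lambda>t. ?a + t *\<^sub>R (?b - ?a)"
  have "\<exists>\<sigma> \<tau>. \<forall>s\<in>T \<union> R. \<sigma> s < \<tau> s \<and> src s = ?\<gamma> (\<sigma> s) \<and> tgt s = ?\<gamma> (\<tau> s)"
    using decomposition_segment(6)[OF E dec] by metis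
  then obtain \<sigma> \<tau> where \<sigma>\<tau>: "\<And>s. s \<in> T \<union> R \<Longrightarrow> \<sigma> s < \<tau> s"
    "\<And>s. s \<in> T \<union> R \<Longrightarrow> src s = ?\<gamma> (\<sigma> s)" "\<And>s. s \<in> T \<union> R \<Longrightarrow> tgt s = ?\<gamma> (\<tau> s)" by metis
  define \<delta> where "\<delta> = sheared N ?b - sheared N ?a"
  define f where "f = (\<lambda>t. \<delta> / det2 ?a ?b / sheared N (?\<gamma> t) + rademacher_at N (?\<gamma> t)
                   - 6 * sgn \<delta> * (if 0 < sheared N (?\<gamma> t) then 1 else 0))"
  note det = edge_ends(2)[OF E]
  have "(\<Sum>s\<in>T \<union> R. defect N (src s) (tgt s)) = (\<Sum>s\<in>T \<union> R. f (\<tau> s) - f (\<sigma> s))"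
  proof (rule sum.cong[OF refl])
    fix s assume s: "s \<in> T \<union> R"
    have "primitive (src s)" "primitive (tgt s)" by (rule decomposition_segment[OF E dec s])+
    then show "defect N (src s) (tgt s) = f (\<tau> s) - f (\<sigma> s)"
      using nz(1)[OF s] unfolding \<sigma>\<tau>(2)[OF s] \<sigma>\<tau>(3)[OF s] f_def \<delta>_def
      by (intro defect_difference \<sigma>\<tau>(1)[OF s] det primitive_lattice) auto
  qed
  also have "\<dots> = f 1 - f 0"
  proof (rule segment_tiling_telescope[where a = ?a and b = ?b])
    show "finite (T \<union> R)" using dec by (auto simp: edge_decomposition_def Let_def split: if_splits)
    show "?a \<noteq> ?b" using det by auto
    show "\<sigma> s < \<tau> s" if "s \<in> T \<union> R" for s by (rule \<sigma>\<tau>(1)[OF that])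
    show "s = closed_segment (?\<gamma> (\<sigma> s)) (?\<gamma> (\<tau> s))" if "s \<in> T \<union> R" for s
      using decomposition_segment(3)[OF E dec that] \<sigma>\<tau>(2,3)[OF that] by simp
    show "\<Union> (T \<union> R) = closed_segment ?a ?b"
      using dec edge_ends(1)[OF E] by (simp add: edge_decomposition_def Let_def)
    show "pairwise (\<lambda>s t. disjnt (rel_interior s) (rel_interior t)) (T \<union> R)"
      using dec by (simp add: edge_decomposition_def Let_def)
  qed
  also have "\<dots> = defect N (?\<gamma> 0) (?\<gamma> 1)"
    unfolding f_def \<delta>_def
    by (rule defect_difference[symmetric])
      (use nz(2,3) det primitive_ends[OF E] primitive_lattice in auto)
  finally show ?thesis by simp
qed

lemma polygon_defect_sum:
  assumes nz: "\<And>v. v \<in> vertices \<Longrightarrow> sheared N v \<noteq> 0"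
  shows "(\<Sum>E\<in>edges. defect N (src E) (tgt E)) =
    dual_area P - 6 * real (card {E \<in> edges. sheared N (src E) * sheared N (tgt E) < 0})"
proof -
  have lat: "src E \<in> lattice" "tgt E \<in> lattice" if "E \<in> edges" for E
    using primitive_ends that primitive_lattice by auto
  have "(\<Sum>E\<in>edges. defect N (src E) (tgt E)) = (\<Sum>E\<in>edges.
      (2 - sheared N (src E) / sheared N (tgt E) - sheared N (tgt E) / sheared N (src E)) / det2 (src E) (tgt E)
      + (rademacher_at N (tgt E) - rademacher_at N (src E))
      - 6 * (if sheared N (src E) * sheared N (tgt E) < 0 then 1 else 0))"
    by (rule sum.cong) (auto simp: defect_eq lat)
  also have "\<dots> = (\<Sum>E\<in>edges. (2 - sheared N (src E) / sheared N (tgt E)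
         - sheared N (tgt E) / sheared N (src E)) / det2 (src E) (tgt E))
      + (\<Sum>E\<in>edges. rademacher_at N (tgt E) - rademacher_at N (src E))
      - 6 * (\<Sum>E\<in>edges. if sheared N (src E) * sheared N (tgt E) < 0 then 1 else 0)"
    by (simp add: sum.distrib sum_subtractf sum_distrib_left)
  also have "(\<Sum>E\<in>edges. rademacher_at N (tgt E) - rademacher_at N (src E)) = 0"
    by (rule sum_edges_telescope)
  also have "(\<Sum>E\<in>edges. (2 - sheared N (src E) / sheared N (tgt E)
         - sheared N (tgt E) / sheared N (src E)) / det2 (src E) (tgt E)) = dual_area P"
    using dual_area_edges[of 1 "of_int N"] nz by (simp add: sheared_def)
  also have "(\<Sum>E\<in>edges. if sheared N (src E) * sheared N (tgt E) < 0 then 1 else 0)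
      = real (card {E \<in> edges. sheared N (src E) * sheared N (tgt E) < 0})"
    using finite_edges by (simp add: sum.If_cases Int_def)
  finally show ?thesis by simp
qed

text \<open>
  A shear is chosen that is generic for all vertices, all endpoints of segments and the cones over all
  segments; then both sides of the formula are evaluations of the sum of all defects.
\<close>

lemma dual_area_formula:
  assumes dec: "polygon_decomposition P T R"
    and K: "\<And>E s. E \<in> edges \<Longrightarrow> s \<in> R E \<Longrightarrow> cone_constant (src s) (tgt s) (K s)"
  obtains c :: nat where "c \<le> 2"
    "dual_area P = 6 * real c - real (\<Sum>E\<in>edges. card (T E)) + (\<Sum>E\<in>edges. \<Sum>s\<in>R E. K s)"
proof -
  have decE: "edge_decomposition P E (T E) (R E)" if "E \<in> edges" for E
    using dec that by (auto simp: polygon_decomposition_def edges_def)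
  define K' where "K' E s = (if s \<in> T E then - 1 else K s)" for E s
  define S where "S = Sigma edges (\<lambda>E. T E \<union> R E)"
  have fin: "finite (T E)" "finite (R E)" "T E \<inter> R E = {}" if E: "E \<in> edges" for E
    using decE[OF E] decomposition_segment(8,9)[OF E decE[OF E]]
    by (auto simp: edge_decomposition_def Let_def split: if_splits)
  have finS: "finite S" unfolding S_def using finite_edges fin by auto
  have K': "cone_constant (src s) (tgt s) (K' E s)" if "(E, s) \<in> S" for E s
  proof (cases "s \<in> T E")
    case True
    have E: "E \<in> edges" and s: "s \<in> T E \<union> R E" using that by (auto simp: S_def)
    note seg = decomposition_segment[OF E decE[OF E] s]
    obtain t where "primitive t" "tgt s = src s + real (edge_height P E) *\<^sub>R t"
        "det2 (src s) t = real (edge_height P E)"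
      using seg(4,8) True by auto
    then show ?thesis using cone_constant_full_width seg(1,7) True by (simp add: K'_def)
  next
    case False
    then show ?thesis using K that by (auto simp: S_def K'_def)
  qed
  let ?V = "vertices \<union> (\<Union>(E, s)\<in>S. {src s, tgt s})"
  let ?Bad = "(\<Union>v\<in>?V. {N. sheared N v = 0}) \<union> (\<Union>(E, s)\<in>S. {N. defect N (src s) (tgt s) \<noteq> K' E s})"
  have "v \<noteq> 0" if v: "v \<in> ?V" for v
  proof -
    have "primitive v"
      using v primitive_vertices decomposition_segment(1,2)[OF _ decE] by (auto simp: S_def)
    then show ?thesis by (auto simp: primitive_iff)
  qed
  then have "finite ?Bad"
    using finite_vertices finS finite_sheared_zero K' unfolding cone_constant_def
    by (intro finite_UnI finite_UN_I) auto
  then obtain N where N: "N \<notin> ?Bad" using ex_new_if_finite infinite_UNIV_int by blast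
  have nz: "sheared N v \<noteq> 0" if "v \<in> ?V" for v using N that by blast
  have "(\<Sum>E\<in>edges. defect N (src E) (tgt E)) = (\<Sum>E\<in>edges. \<Sum>s\<in>T E \<union> R E. defect N (src s) (tgt s))"
  proof (rule sum.cong[OF refl])
    fix E assume E: "E \<in> edges"
    have "src E \<in> vertices" "tgt E \<in> vertices" using ends_in_edge[OF E] by (auto simp: vertices_def)
    then show "defect N (src E) (tgt E) = (\<Sum>s\<in>T E \<union> R E. defect N (src s) (tgt s))"
      using E nz by (intro edge_defect_sum[OF E decE[OF E], symmetric]) (auto simp: S_def)
  qed
  also have "\<dots> = (\<Sum>E\<in>edges. (\<Sum>s\<in>R E. K s) - real (card (T E)))"
  proof (rule sum.cong[OF refl])
    fix E assume E: "E \<in> edges"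
    have "defect N (src s) (tgt s) = K' E s" if "s \<in> T E \<union> R E" for s
      using N E that unfolding S_def by blast
    then have "(\<Sum>s\<in>T E \<union> R E. defect N (src s) (tgt s)) = (\<Sum>s\<in>T E \<union> R E. K' E s)"
      by (intro sum.cong) auto
    also have "\<dots> = (\<Sum>s\<in>T E. K' E s) + (\<Sum>s\<in>R E. K' E s)"
      using fin[OF E] by (intro sum.union_disjoint) auto
    also have "(\<Sum>s\<in>T E. K' E s) = - real (card (T E))" by (simp add: K'_def)
    also have "(\<Sum>s\<in>R E. K' E s) = (\<Sum>s\<in>R E. K s)"
      using fin(3)[OF E] by (intro sum.cong) (auto simp: K'_def)
    finally show "(\<Sum>s\<in>T E \<union> R E. defect N (src s) (tgt s)) = (\<Sum>s\<in>R E. K s) - real (card (T E))"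
      by simp
  qed
  finally have "(\<Sum>E\<in>edges. defect N (src E) (tgt E))
      = (\<Sum>E\<in>edges. \<Sum>s\<in>R E. K s) - real (\<Sum>E\<in>edges. card (T E))"
    by (simp add: sum_subtractf)
  moreover have "(\<Sum>E\<in>edges. defect N (src E) (tgt E)) =
    dual_area P - 6 * real (card {E \<in> edges. sheared N (src E) * sheared N (tgt E) < 0})"
    using nz by (intro polygon_defect_sum) auto
  moreover have "card {E \<in> edges. sheared N (src E) * sheared N (tgt E) < 0} \<le> 2"
    using card_crossings[of 1 "of_int N"] by (simp add: sheared_def)
  ultimately show ?thesis by (intro that) auto
qed

text \<open>
  The lattice points found in the triangle over a residual segment are residual points. A point of
  two such triangles spans a ray that meets the interior of both segments, hence both edges agree.
  The triangle contains a point because width at least 1 and height greater than the width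
  make the determinant at least 2.
\<close>

lemma residual_bounds:
  assumes dec: "polygon_decomposition P T R"
  defines "\<nu> \<equiv> card (residual_points P R)"
  shows "card {E \<in> edges. R E \<noteq> {}} \<le> \<nu>"
    and "\<And>E s. E \<in> edges \<Longrightarrow> s \<in> R E \<Longrightarrow> det2 (src s) (tgt s) \<le> real (2 * \<nu> + 1)"
proof -
  have decE: "edge_decomposition P E (T E) (R E)" if "E \<in> edges" for E
    using dec that by (auto simp: polygon_decomposition_def edges_def)
  let ?pos = "\<lambda>s z. \<exists>\<alpha>>0. \<exists>\<beta>>0. \<alpha> + \<beta> \<le> 1 \<and> z = \<alpha> *\<^sub>R src s + \<beta> *\<^sub>R tgt s"
  define Q where "Q s Z \<longleftrightarrow> finite Z \<and> Z \<subseteq> lattice \<and>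
      det2 (src s) (tgt s) \<le> 2 * real (card Z) + 1 \<and> (\<forall>z\<in>Z. ?pos s z)" for s Z
  have "\<exists>Z. Q s Z"
    if "E \<in> edges" "s \<in> R E" for E s
  proof -
    have s: "s \<in> T E \<union> R E" using that by simp
    note seg = decomposition_segment[OF that(1) decE[OF that(1)] s]
    show ?thesis unfolding Q_def
      by (rule many_lattice_points_in_triangle[OF seg(1,2,5)]) blast
  qed
  then have "\<forall>s\<in>(\<Union>E\<in>edges. R E). \<exists>Z. Q s Z" by blast
  then obtain Z where "\<forall>s\<in>(\<Union>E\<in>edges. R E). Q s (Z s)" using bchoice[of _ Q] by blast
  then have Z: "\<And>E s. E \<in> edges \<Longrightarrow> s \<in> R E \<Longrightarrow> finite (Z s) \<and> Z s \<subseteq> lattice \<and>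
      det2 (src s) (tgt s) \<le> 2 * real (card (Z s)) + 1 \<and> (\<forall>z\<in>Z s. ?pos s z)"
    unfolding Q_def by blast
  have fin: "finite (residual_points P R)"
    by (rule finite_subset[OF _ finite_lattice_points[OF compact_imp_bounded[OF compact_P]]])
      (auto simp: residual_points_def)
  have sub: "Z s \<subseteq> residual_points P R" if E: "E \<in> edges" and s: "s \<in> R E" for E s
  proof
    fix z assume z: "z \<in> Z s"
    then obtain \<alpha> \<beta> where ab: "0 < \<alpha>" "0 < \<beta>" "\<alpha> + \<beta> \<le> 1" "z = \<alpha> *\<^sub>R src s + \<beta> *\<^sub>R tgt s"
      using Z[OF E s] by blast
    have s': "s \<in> T E \<union> R E" using s by simp
    note seg = decomposition_segment[OF E decE[OF E] s']
    have "s \<subseteq> E" using decE[OF E] s by (auto simp: edge_decomposition_def Let_def)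
    then have "s \<subseteq> P" using edge_subset[OF E] by blast
    moreover have "src s \<in> s" "tgt s \<in> s" using seg(3) ends_in_segment by metis+
    ultimately have "{0, src s, tgt s} \<subseteq> P" using origin interior_subset by blast
    then have "convex hull {0, src s, tgt s} \<subseteq> P" using convex_P by (rule hull_minimal)
    moreover have "z = (1 - \<alpha> - \<beta>) *\<^sub>R 0 + \<alpha> *\<^sub>R src s + \<beta> *\<^sub>R tgt s"
      "0 \<le> 1 - \<alpha> - \<beta>" "1 - \<alpha> - \<beta> + \<alpha> + \<beta> = 1" using ab by auto
    then have "z \<in> convex hull {0, src s, tgt s}"
      unfolding convex_hull_3 using ab(1,2) less_imp_le by blast
    moreover have "z \<in> interior (conic hull s)"
      using positive_combination_in_cone[OF seg(5) ab(1,2)] seg(3) ab(4) by simp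
    moreover have "z \<in> lattice" using Z[OF E s] z by blast
    ultimately show "z \<in> residual_points P R"
      using E s by (auto simp: residual_points_def edges_def)
  qed
  show "det2 (src s) (tgt s) \<le> real (2 * \<nu> + 1)" if E: "E \<in> edges" and s: "s \<in> R E" for E s
    using Z[OF E s] card_mono[OF fin sub[OF E s]] by (simp add: \<nu>_def)
  have nonempty: "Z s \<noteq> {}" if E: "E \<in> edges" and s: "s \<in> R E" for E s
  proof -
    have s': "s \<in> T E \<union> R E" using s by simp
    note seg = decomposition_segment[OF E decE[OF E] s']
    obtain t where t: "tgt s = src s + real (lattice_width s) *\<^sub>R t" "det2 (src s) t = real (edge_height P E)"
      using seg(4) by blast
    have "det2 (src s) (tgt s) = real (lattice_width s) * real (edge_height P E)"
      by (subst t(1)) (simp add: t(2))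
    moreover have "1 \<le> lattice_width s" "2 \<le> edge_height P E" using seg(9) s by auto
    then have "1 * 2 \<le> lattice_width s * edge_height P E" by (intro mult_le_mono)
    then have "2 \<le> real (lattice_width s) * real (edge_height P E)"
      by (metis mult_1 of_nat_le_iff of_nat_mult of_nat_numeral)
    ultimately have "0 < real (card (Z s))" using Z[OF E s] by auto
    then show ?thesis by auto
  qed
  have same: "E = E'" if E: "E \<in> edges" "E' \<in> edges" and s: "s \<in> R E" "s' \<in> R E'" and z: "z \<in> Z s" "z \<in> Z s'"
    for E E' s s' z
  proof -
    have on: "\<exists>x c. 0 < c \<and> x = c *\<^sub>R z \<and> x \<in> open_segment (src s) (tgt s) \<and> src s \<in> E \<and> tgt s \<in> E \<and> x \<in> E"
      if E: "E \<in> edges" and s: "s \<in> R E" and z: "z \<in> Z s" for E s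
    proof -
      obtain \<alpha> \<beta> where ab: "0 < \<alpha>" "0 < \<beta>" "z = \<alpha> *\<^sub>R src s + \<beta> *\<^sub>R tgt s"
        using Z[OF E s] z by blast
      have s': "s \<in> T E \<union> R E" using s by simp
      note seg = decomposition_segment[OF E decE[OF E] s']
      have sE: "s \<subseteq> E" using decE[OF E] s by (auto simp: edge_decomposition_def Let_def)
      let ?x = "(1 / (\<alpha> + \<beta>)) *\<^sub>R z" and ?t = "\<beta> / (\<alpha> + \<beta>)"
      have "?x = (1 - ?t) *\<^sub>R src s + ?t *\<^sub>R tgt s"
      proof -
        have "1 - ?t = \<alpha> / (\<alpha> + \<beta>)" using ab by (simp add: field_simps)
        then show ?thesis using ab by (simp add: scaleR_add_right)
      qed
      moreover have "src s \<noteq> tgt s" using seg(5) by auto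
      moreover have "0 < ?t" "?t < 1" using ab by auto
      ultimately have x: "?x \<in> open_segment (src s) (tgt s)" unfolding in_segment by blast
      then have "?x \<in> s" "src s \<in> s" "tgt s \<in> s"
        using seg(3) open_closed_segment ends_in_segment by metis+
      moreover have "0 < 1 / (\<alpha> + \<beta>)" using ab by simp
      ultimately show ?thesis using x sE by blast
    qed
    obtain x c where x: "0 < c" "x = c *\<^sub>R z" "x \<in> open_segment (src s) (tgt s)" "src s \<in> E" "tgt s \<in> E" "x \<in> E"
      using on[OF E(1) s(1) z(1)] by blast
    obtain x' c' where x': "0 < c'" "x' = c' *\<^sub>R z" "x' \<in> E'"
      using on[OF E(2) s(2) z(2)] by blast
    have eq: "x' = (c' / c) *\<^sub>R x" using x x' by simp
    have "c' / c = 1"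
      by (rule ray_meets_boundary_once[OF E x(6)]) (use eq x' x(1) in simp_all)
    then have "x \<in> E'" using eq x'(3) by simp
    then show ?thesis using edges_meeting_inside_eq[OF E x(4,5,3)] by blast
  qed
  let ?A = "{E \<in> edges. R E \<noteq> {}}"
  define Y where "Y E = (\<Union>s\<in>R E. Z s)" for E
  have "Y E \<noteq> {}" if E: "E \<in> ?A" for E
  proof -
    obtain s where "s \<in> R E" using E by blast
    then show ?thesis using nonempty[of E s] E unfolding Y_def by simp blast
  qed
  then have "\<exists>g. \<forall>E\<in>?A. g E \<in> Y E" by (intro bchoice) auto
  then obtain g where g: "\<And>E. E \<in> ?A \<Longrightarrow> \<exists>s\<in>R E. g E \<in> Z s"
    unfolding Y_def by auto
  have "inj_on g ?A"
  proof (rule inj_onI)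
    fix E E' assume E: "E \<in> ?A" "E' \<in> ?A" "g E = g E'"
    obtain s s' where "s \<in> R E" "g E \<in> Z s" "s' \<in> R E'" "g E' \<in> Z s'"
      using g[OF E(1)] g[OF E(2)] by blast
    then show "E = E'" using E same[of E E' s s' "g E"] by simp
  qed
  moreover have "g ` ?A \<subseteq> residual_points P R"
  proof
    fix z assume "z \<in> g ` ?A"
    then obtain E where E: "E \<in> ?A" "z = g E" by blast
    then show "z \<in> residual_points P R" using g[OF E(1)] sub[of E] by auto
  qed
  ultimately show "card ?A \<le> \<nu>" unfolding \<nu>_def using card_inj_on_le fin by blast
qed

end

section \<open>Finiteness\<close>

lemma finite_bounded_sums:
  fixes V :: "real set"
  assumes "finite V"
  shows "\<exists>S. finite S \<and> (\<forall>(A :: 'a set) k. finite A \<longrightarrow> card A \<le> n \<longrightarrow> k ` A \<subseteq> V \<longrightarrow> sum k A \<in> S)"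
proof (induction n)
  case 0
  have "sum k A \<in> {0}" if "finite A" "card A \<le> 0" for A :: "'a set" and k :: "'a \<Rightarrow> real"
    using that by simp
  then show ?case by blast
next
  case (Suc n)
  then obtain S where S: "finite S"
    "\<And>(A :: 'a set) k. finite A \<Longrightarrow> card A \<le> n \<Longrightarrow> k ` A \<subseteq> V \<Longrightarrow> sum k A \<in> S" by blast
  have "sum k A \<in> insert 0 ((\<lambda>(v, s). v + s) ` (V \<times> S))"
    if A: "finite A" "card A \<le> Suc n" "k ` A \<subseteq> V" for A :: "'a set" and k
  proof (cases "A = {}")
    case False
    then obtain x where x: "x \<in> A" by blast
    then have "sum k A = k x + sum k (A - {x})" using A by (simp add: sum.remove)
    moreover have "sum k (A - {x}) \<in> S" using A x by (intro S(2)) auto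
    moreover have "k x \<in> V" using A x by blast
    ultimately show ?thesis by auto
  qed simp
  moreover have "finite (insert 0 ((\<lambda>(v, s). v + s) ` (V \<times> S)))" using S(1) assms by simp
  ultimately show ?case by blast
qed

theorem corollary1p9:
  fixes \<nu> :: nat
  shows "finite {dual_area P | P. fano_polygon P \<and> has_residual_points P \<nu>} \<and>
         finite {card (polygon_vertices P) | P. fano_polygon P \<and> has_residual_points P \<nu>}"
proof -
  obtain V where V: "finite V" "\<And>u w. primitive u \<Longrightarrow> primitive w \<Longrightarrow> 0 < det2 u w \<Longrightarrow>
      det2 u w \<le> real (2 * \<nu> + 1) \<Longrightarrow> \<exists>K\<in>V. cone_constant u w K"
    using finite_cone_constants[of "2 * \<nu> + 1"] by blast
  obtain S where S: "finite S" "\<And>(A :: (real^2) set set) k. finite A \<Longrightarrow> card A \<le> \<nu> \<Longrightarrow>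
      k ` A \<subseteq> V \<Longrightarrow> sum k A \<in> S"
    using finite_bounded_sums[OF V(1), of \<nu>] by blast
  \<comment> \<open>An upper bound for \<open>n = 6 c + s - dual area\<close>, as \<open>c \<le> 2\<close> and the dual area is not negative.\<close>
  define B where "B = nat \<lfloor>12 + (\<Sum>s\<in>S. \<bar>s\<bar>)\<rfloor>"
  have main: "dual_area P \<in> (\<lambda>(c, n, s). 6 * real c - real n + s) ` ({..2} \<times> {..B} \<times> S)
      \<and> card (polygon_vertices P) \<le> B + \<nu>"
    if fano: "fano_polygon P" and res: "has_residual_points P \<nu>" for P
  proof -
    interpret polygon_around_origin P
      using fano by unfold_locales (auto simp: fano_polygon_def)
    interpret fano P
      using fano by unfold_locales (auto simp: fano_polygon_def vertices_def polygon_vertices_def)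
    obtain T R where dec: "polygon_decomposition P T R" and card: "card (residual_points P R) = \<nu>"
      using res by (auto simp: has_residual_points_def)
    have decE: "edge_decomposition P E (T E) (R E)" if "E \<in> edges" for E
      using dec that by (auto simp: polygon_decomposition_def edges_def)
    note bounds = residual_bounds[OF dec, unfolded card]
    have "\<exists>K\<in>V. cone_constant (src s) (tgt s) K" if E: "E \<in> edges" and s: "s \<in> R E" for E s
    proof -
      have "s \<in> T E \<union> R E" using s by simp
      note seg = decomposition_segment[OF E decE[OF E] this]
      show ?thesis using V(2) seg(1,2,5) bounds(2)[OF E s] by blast
    qed
    then have "\<forall>s\<in>(\<Union>E\<in>edges. R E). \<exists>K. K \<in> V \<and> cone_constant (src s) (tgt s) K" by blast
    then obtain K where K: "\<And>E s. E \<in> edges \<Longrightarrow> s \<in> R E \<Longrightarrow> K s \<in> V \<and> cone_constant (src s) (tgt s) (K s)"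
      using bchoice[of "\<Union>E\<in>edges. R E" "\<lambda>s K. K \<in> V \<and> cone_constant (src s) (tgt s) K"]
      by blast
    obtain c where c: "c \<le> 2"
      "dual_area P = 6 * real c - real (\<Sum>E\<in>edges. card (T E)) + (\<Sum>E\<in>edges. \<Sum>s\<in>R E. K s)"
      using dual_area_formula[OF dec] K by metis
    let ?A = "{E \<in> edges. R E \<noteq> {}}"
    let ?n = "\<Sum>E\<in>edges. card (T E)"
    have single: "R E = {} \<or> (\<exists>s. R E = {s})" if "E \<in> edges" for E
      using decE[OF that] by (auto simp: edge_decomposition_def Let_def split: if_splits)
    have "(\<Sum>E\<in>edges. \<Sum>s\<in>R E. K s) = (\<Sum>E\<in>?A. \<Sum>s\<in>R E. K s)"
      using finite_edges by (intro sum.mono_neutral_right) auto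
    also have "\<dots> \<in> S"
    proof (rule S(2))
      show "finite ?A" using finite_edges by simp
      show "card ?A \<le> \<nu>" by (rule bounds(1))
      show "(\<lambda>E. \<Sum>s\<in>R E. K s) ` ?A \<subseteq> V" using single K by fastforce
    qed
    finally have inS: "(\<Sum>E\<in>edges. \<Sum>s\<in>R E. K s) \<in> S" .
    have "0 \<le> dual_area P" by (simp add: dual_area_def)
    moreover have "(\<Sum>E\<in>edges. \<Sum>s\<in>R E. K s) \<le> (\<Sum>s\<in>S. \<bar>s\<bar>)"
      using member_le_sum[OF inS, of abs] S(1) by (simp add: abs_le_iff)
    ultimately have "real ?n \<le> 12 + (\<Sum>s\<in>S. \<bar>s\<bar>)" using c by linarith
    then have n: "?n \<le> B" unfolding B_def by linarith
    have "dual_area P \<in> (\<lambda>(c, n, s). 6 * real c - real n + s) ` ({..2} \<times> {..B} \<times> S)"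
      using c inS n by (intro image_eqI[where x = "(c, ?n, \<Sum>E\<in>edges. \<Sum>s\<in>R E. K s)"]) auto
    moreover have "card (polygon_vertices P) \<le> B + \<nu>"
    proof -
      have "card (polygon_vertices P) = card edges"
        using bij_betw_same_card[OF bij_betw_src] by (simp add: vertices_def polygon_vertices_def)
      also have "edges \<subseteq> {E \<in> edges. T E \<noteq> {}} \<union> ?A"
      proof
        fix E assume E: "E \<in> edges"
        have "\<Union> (T E \<union> R E) = E" using decE[OF E] by (simp add: edge_decomposition_def Let_def)
        then show "E \<in> {E \<in> edges. T E \<noteq> {}} \<union> ?A" using ends_in_edge(1)[OF E] E by auto
      qed
      then have "card edges \<le> card {E \<in> edges. T E \<noteq> {}} + card ?A"
        using finite_edges by (intro order_trans[OF card_mono card_Un_le]) auto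
      also have "card {E \<in> edges. T E \<noteq> {}} = (\<Sum>E\<in>{E \<in> edges. T E \<noteq> {}}. 1)" by simp
      also have "\<dots> \<le> (\<Sum>E\<in>{E \<in> edges. T E \<noteq> {}}. card (T E))"
      proof (rule sum_mono)
        fix E assume "E \<in> {E \<in> edges. T E \<noteq> {}}"
        then show "1 \<le> card (T E)"
          using decE[of E] card_gt_0_iff[of "T E"] by (auto simp: edge_decomposition_def Let_def Suc_le_eq)
      qed
      also have "\<dots> \<le> ?n" using finite_edges by (intro sum_mono2) auto
      also note n
      finally show ?thesis using bounds(1) by simp
    qed
    ultimately show ?thesis by blast
  qed
  have "finite ((\<lambda>(c, n, s). 6 * real c - real n + s) ` ({..2} \<times> {..B} \<times> S))"
    using S(1) by simp
  moreover have "{dual_area P | P. fano_polygon P \<and> has_residual_points P \<nu>}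
      \<subseteq> (\<lambda>(c, n, s). 6 * real c - real n + s) ` ({..2} \<times> {..B} \<times> S)"
    using main by blast
  moreover have "{card (polygon_vertices P) | P. fano_polygon P \<and> has_residual_points P \<nu>} \<subseteq> {..B + \<nu>}"
    using main by auto
  ultimately show ?thesis by (meson finite_atMost finite_subset)
qed

end
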